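(* Let $n$ be a non-negative integer. If $n\le 7$, then $\mathcal S_n/{\sim_{\mathrm{sw}}}=\Omega_n/{\sim_{\mathrm{sw}}}$, and otherwise $$\mathcal S_n/{\sim_{\mathrm{sw}}}=\Omega_n/{\sim_{\mathrm{sw}}}\ \sqcup\ \{[S(K_n)]\}\ \sqcup\ \bigl\{[S(D_{m-2,\,n-m+2})] : m\in\{\max\{9,\lceil n/2\rceil+2\},\ldots,n+1\}\bigr\}.$$ If $n\le 8$, then $\mathcal T_n/{\sim_{\mathrm{sw}}}=\Theta_n/{\sim_{\mathrm{sw}}}$, and otherwise $$\mathcal T_n/{\sim_{\mathrm{sw}}}=\Omega_n/{\sim_{\mathrm{sw}}}\ \sqcup\ \bigl\{[S(D_{m-2,\,n-m+2})] : m\in\{\max\{9,\lceil n/2\rceil+2\},\ldots,n\}\bigr\}.$$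
   Context: Graphs are finite, undirected, without loops or multiple edges; $A(G)$ is the adjacency matrix of $G$. A Seidel matrix is a real symmetric matrix with zero diagonal and all off-diagonal entries $\pm1$. Two Seidel matrices $S,S'$ are switching equivalent, $S\sim_{\mathrm{sw}}S'$, if $P^\top SP=S'$ for some signed permutation matrix $P$; $[S]$ denotes the switching class of $S$, and $X/{\sim_{\mathrm{sw}}}$ is the set of switching classes of elements of a set $X$ of Seidel matrices. For a graph $G$, $S(G):=J-I-2A(G)$, where $J$ is the all-one matrix and $I$ the identity. For a non-negative integer $n$: $\mathcal S_n$ is the set of Seidel matrices of order $n$ with largest eigenvalue at most $3$; $\mathcal T_n$ is the set of Seidel matrices of order $n$ with largest eigenvalue equal to $3$; $\Omega_n:=\{S\in\mathcal S_n:\operatorname{rank}(3I-S)\le 7\}$; $\Theta_n:=\Omega_n\cap\mathcal T_n$. (For $n=0$ the empty $0\times 0$ matrix is the only Seidel matrix; it has rank $0$ and belongs to $\mathcal S_0$ but not to $\mathcal T_0$.) $K_n$ is the complete graph of order $n$. For non-negative integers $a\ge b$, $D_{a,b}$ is the graph obtained from the complete graph $K_{a+b}$ by removing a matching of size $b$ (i.e. $b$ pairwise disjoint edges). The symbol $\sqcup$ denotes a disjoint union (disjointness is part of the assertion). *)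

theory Defs
  imports
    "HOL-Library.Disjoint_Sets"
    "Jordan_Normal_Form.Char_Poly"
    "Jordan_Normal_Form.DL_Rank"
begin

section \<open>Seidel matrices and switching\<close>

definition seidel_mat :: "real mat \<Rightarrow> bool" where
  "seidel_mat S \<longleftrightarrow> square_mat S \<and> S\<^sup>T = S \<and>
     (\<forall>i < dim_row S. S $$ (i, i) = 0) \<and>
     (\<forall>i < dim_row S. \<forall>j < dim_row S. i \<noteq> j \<longrightarrow> S $$ (i, j) \<in> {1, -1})"

definition signed_perm_mat :: "nat \<Rightarrow> real mat \<Rightarrow> bool" where
  "signed_perm_mat n P \<longleftrightarrow> P \<in> carrier_mat n n \<and>
     (\<forall>i < n. \<forall>j < n. P $$ (i, j) \<in> {0, 1, -1}) \<and>
     (\<forall>i < n. \<exists>!j. j < n \<and> P $$ (i, j) \<noteq> 0) \<and>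
     (\<forall>j < n. \<exists>!i. i < n \<and> P $$ (i, j) \<noteq> 0)"

definition switching_rel :: "(real mat \<times> real mat) set" where
  "switching_rel = {(S, S'). seidel_mat S \<and> seidel_mat S' \<and>
     (\<exists>P. signed_perm_mat (dim_row S) P \<and> P\<^sup>T * S * P = S')}"

definition switching_class :: "real mat \<Rightarrow> real mat set" where
  "switching_class S = switching_rel `` {S}"


section \<open>Seidel matrices with bounded largest eigenvalue\<close>

text \<open>The empty matrix has no eigenvalue at all. So ``largest eigenvalue at most 3'' is read as
  ``every eigenvalue is at most 3'' (which holds vacuously for order 0), whereas ``largest eigenvalue
  equal to 3'' includes that 3 is an eigenvalue (which fails for order 0). Seidel matrices are real
  symmetric, so the real eigenvalues are all the eigenvalues.\<close>

definition seidel_le3 :: "nat \<Rightarrow> real mat set" (\<open>\<S>\<close>) where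
  "\<S> n = {S. seidel_mat S \<and> dim_row S = n \<and> (\<forall>k. eigenvalue S k \<longrightarrow> k \<le> 3)}"

definition seidel_eq3 :: "nat \<Rightarrow> real mat set" (\<open>\<T>\<close>) where
  "\<T> n = {S. seidel_mat S \<and> dim_row S = n \<and> eigenvalue S 3 \<and> (\<forall>k. eigenvalue S k \<longrightarrow> k \<le> 3)}"

definition Omega :: "nat \<Rightarrow> real mat set" (\<open>\<Omega>\<close>) where
  "\<Omega> n = {S \<in> \<S> n. vec_space.rank n (3 \<cdot>\<^sub>m 1\<^sub>m n - S) \<le> 7}"

definition Theta :: "nat \<Rightarrow> real mat set" (\<open>\<Theta>\<close>) where
  "\<Theta> n = \<Omega> n \<inter> \<T> n"


section \<open>Graphs and their Seidel matrices\<close>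

text \<open>A pair \<open>(n, E)\<close> stands for the graph with vertex set \<open>{..<n}\<close> and edge set \<open>E\<close>.\<close>

type_synonym graph = "nat \<times> nat set set"

definition simple_graph :: "graph \<Rightarrow> bool" where
  "simple_graph G \<longleftrightarrow> (\<forall>e \<in> snd G. e \<subseteq> {..<fst G} \<and> card e = 2)"

definition adj_matrix :: "graph \<Rightarrow> real mat" where
  "adj_matrix G = mat (fst G) (fst G) (\<lambda>(i, j). if {i, j} \<in> snd G then 1 else 0)"

definition all_ones_mat :: "nat \<Rightarrow> real mat" where
  "all_ones_mat n = mat n n (\<lambda>_. 1)"

definition seidel_of_graph :: "graph \<Rightarrow> real mat" where
  "seidel_of_graph G = all_ones_mat (fst G) - 1\<^sub>m (fst G) - 2 \<cdot>\<^sub>m adj_matrix G"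

definition complete_graph :: "nat \<Rightarrow> graph" where
  "complete_graph n = (n, {e. e \<subseteq> {..<n} \<and> card e = 2})"

definition std_matching :: "nat \<Rightarrow> nat set set" where
  "std_matching b = (\<lambda>i. {2 * i, 2 * i + 1}) ` {..<b}"

text \<open>The graph \<open>D\<^bsub>a,b\<^esub>\<close>, meaningful for \<open>b \<le> a\<close>. All matchings of size \<open>b\<close> in a complete graph are
  related by automorphisms, so one of them is fixed.\<close>

definition D_graph :: "nat \<Rightarrow> nat \<Rightarrow> graph" where
  "D_graph a b = (a + b, snd (complete_graph (a + b)) - std_matching b)"

lemma simple_complete_graph: "simple_graph (complete_graph n)"
  by (auto simp: simple_graph_def complete_graph_def)

lemma simple_D_graph: "simple_graph (D_graph a b)"
  by (auto simp: simple_graph_def complete_graph_def D_graph_def)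

lemma card_std_matching: "card (std_matching b) = b"
proof -
  have "inj_on (\<lambda>i::nat. {2 * i, 2 * i + 1}) {..<b}"
    by (rule inj_onI) (auto simp: doubleton_eq_iff)
  then show ?thesis by (simp add: std_matching_def card_image)
qed

lemma disjoint_std_matching: "disjoint (std_matching b)"
  unfolding std_matching_def disjoint_def by (auto, presburger+)

lemma std_matching_subset:
  assumes "b \<le> a"
  shows "std_matching b \<subseteq> snd (complete_graph (a + b))"
  using assms by (auto simp: std_matching_def complete_graph_def)

end

theory Submission
  imports Defs "HOL-Library.Function_Algebras"
begin

text \<open>Call \<open>x \<bullet> x\<close> the norm of \<open>x\<close>. All eigenvalues of a Seidel matrix \<open>S\<close> are at most 3 exactly when \<open>G = 3I - S\<close> is positive
semidefinite. Then \<open>G\<close> is the Gram matrix of vectors \<open>v\<^sub>i\<close> of norm 3 with mutual inner products \<open>\<plusminus>1\<close>,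
switching changes signs of these vectors and permutes them, and the rank of \<open>G\<close> is the dimension of their span.
No such vectors are constructed: the unit coordinate vectors serve as the \<open>v\<^sub>i\<close>, in the space
\<open>nat \<Rightarrow> real\<close> with the semidefinite form given by \<open>G\<close>, and identities between vectors hold
modulo the radical of this form.

The main point is that rank at least 8 forces \<open>S\<close> to be equivalent to some \<open>S(D\<^sub>a\<^sub>,\<^sub>b)\<close>, where
\<open>D\<^sub>n\<^sub>,\<^sub>0\<close> is the complete graph. Suppose first that every triangle is positive, that is, the product of its three
inner products is 1. Then all inner products become \<open>1\<close> after switching, which is the
complete graph (\<open>no_negative_triangle_matching\<close>). Otherwise, after switching, three of the vectors have
mutual inner products \<open>-1\<close>. The negated half-sums of any two of them are orthonormal vectors \<open>u\<^sub>0, u\<^sub>1, u\<^sub>2\<close>, and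
every \<open>v\<^sub>i\<close> is either one of the vectors \<open>\<plusminus>u\<^sub>0 \<plusminus> u\<^sub>1 \<plusminus> u\<^sub>2\<close> or of the form \<open>\<plusminus>u\<^sub>k + w\<^sub>i\<close> with \<open>w\<^sub>i\<close> of norm 2 orthogonal to the \<open>u\<close>s. In the second case
\<open>v\<^sub>i\<close> belongs to the \<open>k\<close>-th pillar.

If at most one pillar is inhabited, its \<open>u\<^sub>k\<close> is a unit vector whose inner products with all the \<open>v\<^sub>i\<close>
are \<open>\<plusminus>1\<close>. Switching makes them all 1. Then \<open>v\<^sub>i = u\<^sub>k + w\<^sub>i\<close> for all \<open>i\<close>, with \<open>w\<^sub>i\<close> of norm 2 that are pairwise
orthogonal or opposite; the opposite pairs form the matching removed from the complete graph
(\<open>unit_vector_matching\<close>). If two pillars are inhabited, the rank is at most \<open>3 + 2 + 2 = 7\<close>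
(\<open>pillars_span_seven\<close>): three dimensions come from the \<open>u\<close>s and two from \<open>w\<close>s in different pillars. Modulo those,
every other \<open>w\<close> vanishes or becomes, up to sign, one of a set of vectors of norm \<open>4/3\<close> with inner products \<open>4/3\<close> or
\<open>-2/3\<close>, and there are at most three distinct such vectors, which form an equilateral triangle in a plane
(\<open>triangle_spans_two\<close>).

Conversely the quadratic form of \<open>3I - S(D\<^sub>a\<^sub>,\<^sub>b)\<close> is a sum of squares, from which one reads off that it is
semidefinite and has rank \<open>a + 1\<close> if \<open>b > 0\<close>, and full rank \<open>a\<close> if \<open>b = 0\<close>. As the rank is a switching invariant, it decides
which of these classes lie outside \<open>\<Omega>\<close> and which have 3 as an eigenvalue. The complete graph is
told apart from the other \<open>D\<^sub>a\<^sub>,\<^sub>b\<close> by the signs of triangles.\<close>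

section \<open>Positive semidefinite forms\<close>

locale semidefinite_form =
  fixes n :: nat and G :: "nat \<Rightarrow> nat \<Rightarrow> real"
  assumes sym: "\<And>i j. i < n \<Longrightarrow> j < n \<Longrightarrow> G i j = G j i"
    and nonneg: "\<And>x. 0 \<le> (\<Sum>i<n. \<Sum>j<n. x i * G i j * x j)"
begin

definition form :: "(nat \<Rightarrow> real) \<Rightarrow> (nat \<Rightarrow> real) \<Rightarrow> real" where
  "form x y = (\<Sum>i<n. \<Sum>j<n. x i * G i j * y j)"

definition scale :: "real \<Rightarrow> (nat \<Rightarrow> real) \<Rightarrow> nat \<Rightarrow> real" (infixr \<open>*\<^sub>f\<close> 75) where
  "c *\<^sub>f x = (\<lambda>i. c * x i)"

definition unit :: "nat \<Rightarrow> nat \<Rightarrow> real" where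
  "unit i = (\<lambda>j. if j = i then 1 else 0)"

lemma form_commute: "form x y = form y x"
proof -
  have "form x y = (\<Sum>j<n. \<Sum>i<n. x i * G i j * y j)"
    unfolding form_def by (rule sum.swap)
  also have "\<dots> = form y x"
    unfolding form_def by (intro sum.cong refl) (simp add: sym)
  finally show ?thesis .
qed

lemma form_add_left: "form (x + y) z = form x z + form y z"
  by (simp add: form_def algebra_simps sum.distrib)

lemma form_diff_left: "form (x - y) z = form x z - form y z"
  by (simp add: form_def algebra_simps sum_subtractf)

lemma form_scale_left: "form (c *\<^sub>f x) z = c * form x z"
  by (simp add: form_def scale_def sum_distrib_left mult.assoc)

lemma form_add_right: "form z (x + y) = form z x + form z y"
  by (metis form_add_left form_commute)

lemma form_diff_right: "form z (x - y) = form z x - form z y"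
  by (metis form_diff_left form_commute)

lemma form_scale_right: "form z (c *\<^sub>f x) = c * form z x"
  by (metis form_scale_left form_commute)

lemmas form_simps = form_add_left form_diff_left form_scale_left
  form_add_right form_diff_right form_scale_right

lemma form_unit_left: "i < n \<Longrightarrow> form (unit i) y = (\<Sum>j<n. G i j * y j)"
proof -
  assume i: "i < n"
  have "form (unit i) y = (\<Sum>k<n. if k = i then \<Sum>j<n. G k j * y j else 0)"
    unfolding form_def unit_def by (intro sum.cong refl) simp
  then show ?thesis using i by simp
qed

lemma form_unit_unit: "i < n \<Longrightarrow> j < n \<Longrightarrow> form (unit i) (unit j) = G i j"
  by (simp add: form_unit_left) (simp add: unit_def if_distrib cong: if_cong)

lemma form_nonneg: "0 \<le> form x x"
  using nonneg by (simp add: form_def)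

lemma form_Cauchy_Schwarz: "(form x y)\<^sup>2 \<le> form x x * form y y"
proof (cases "form y y = 0")
  case True
  have "form x y = 0"
  proof (rule ccontr)
    assume nz: "form x y \<noteq> 0"
    define t where "t = - (form x x + 1) / (2 * form x y)"
    have "form (x + t *\<^sub>f y) (x + t *\<^sub>f y) = form x x + 2 * t * form x y"
      using True by (simp add: form_simps form_commute[of y x] algebra_simps)
    also have "\<dots> = -1" using nz by (simp add: t_def field_simps)
    finally show False using form_nonneg[of "x + t *\<^sub>f y"] by simp
  qed
  then show ?thesis using True by simp
next
  case False
  then have pos: "form y y > 0" using form_nonneg[of y] by simp
  let ?z = "form y y *\<^sub>f x - form x y *\<^sub>f y"
  have "form ?z ?z = form y y * (form x x * form y y - (form x y)\<^sup>2)"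
    by (simp add: form_simps form_commute[of y x] algebra_simps power2_eq_square)
  then show ?thesis using form_nonneg[of ?z] pos by (simp add: zero_le_mult_iff)
qed

lemma form_null: "form x x = 0 \<Longrightarrow> form x t = 0"
  using form_Cauchy_Schwarz[of x t] by simp

text \<open>Two vectors at distance zero cannot be told apart by the form.\<close>

lemma form_cong_null: "form (x - y) (x - y) = 0 \<Longrightarrow> form x t = form y t"
  using form_null[of "x - y" t] by (simp add: form_simps)

lemma form_abs_le: "form x x = r \<Longrightarrow> form y y = r \<Longrightarrow> \<bar>form x y\<bar> \<le> r"
  using form_Cauchy_Schwarz[of x y] form_nonneg[of x]
  by (metis abs_le_square_iff abs_of_nonneg power2_eq_square)

text \<open>Two vectors of \<open>X\<close> at inner product \<open>4/3\<close> coincide. If \<open>a\<close>, \<open>b\<close> and \<open>x\<close> are pairwise distinct, then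
\<open>a + b + x\<close> has norm \<open>3 \<cdot> 4/3 - 6 \<cdot> 2/3 = 0\<close>. So \<open>x\<close> is determined by \<open>a\<close> and \<open>b\<close>.\<close>

lemma triangle_spans_two:
  assumes norm: "\<And>x. x \<in> X \<Longrightarrow> form x x = 4/3"
    and inner: "\<And>x y. x \<in> X \<Longrightarrow> y \<in> X \<Longrightarrow> form x y \<in> {4/3, -2/3}"
  obtains a b where "\<And>x t. x \<in> X \<Longrightarrow> form a t = 0 \<Longrightarrow> form b t = 0 \<Longrightarrow> form x t = 0"
proof -
  have same: "form x t = form y t" if "x \<in> X" "y \<in> X" "form x y = 4/3" for x y t
    by (rule form_cong_null) (use that norm[OF that(1)] norm[OF that(2)] in \<open>simp add: form_simps form_commute[of y x]\<close>)
  show thesis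
  proof (cases "\<exists>a\<in>X. \<exists>b\<in>X. form a b = -2/3")
    case True
    then obtain a b where ab: "a \<in> X" "b \<in> X" "form a b = -2/3" by blast
    show thesis
    proof (rule that[of a b])
      fix x t assume x: "x \<in> X" and t: "form a t = 0" "form b t = 0"
      show "form x t = 0"
      proof (cases "form x a = 4/3 \<or> form x b = 4/3")
        case True
        then show ?thesis using same[OF x ab(1)] same[OF x ab(2)] t by metis
      next
        case False
        then have "form x a = -2/3" "form x b = -2/3"
          using inner[OF x ab(1)] inner[OF x ab(2)] by auto
        then have "form (x + a + b) (x + a + b) = 0"
          using ab norm[OF x] norm[OF ab(1)] norm[OF ab(2)]
          by (simp add: form_simps form_commute[of a x] form_commute[of b x] form_commute[of b a])
        then have "form (x + a + b) t = 0" by (rule form_null)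
        then show ?thesis using t by (simp add: form_simps)
      qed
    qed
  next
    case False
    show thesis
    proof (cases "X = {}")
      case True
      then show thesis using that by blast
    next
      case False
      then obtain a where a: "a \<in> X" by blast
      have "form x t = form a t" if "x \<in> X" for x t
        using same[OF that a] inner[OF that a] \<open>\<not> (\<exists>a\<in>X. \<exists>b\<in>X. form a b = -2/3)\<close> that a by blast
      then show thesis using that[of a a] by simp
    qed
  qed
qed

section \<open>Norm-two vectors in three colours\<close>

text \<open>This is the step that bounds the rank when two pillars occur; the colours are the pillars. Choose \<open>x\<close>
and \<open>y\<close> of different colours with inner product 1, changing a sign if necessary. Give every vector the sign that makes
its pair of inner products with \<open>x\<close> and \<open>y\<close> equal to \<open>(0,1)\<close>, \<open>(1,0)\<close> or
\<open>(-1,-1)\<close>, according to its colour; if this is impossible, the vector is \<open>\<plusminus>x\<close>, \<open>\<plusminus>y\<close> or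
\<open>\<plusminus>(y - x)\<close>. The three pairs are themselves an equilateral triangle in the dual of the plane of \<open>x\<close> and \<open>y\<close>, with
norm \<open>2/3\<close> and inner products \<open>-1/3\<close>. So the components orthogonal to this plane have norm
\<open>4/3\<close> and inner products \<open>4/3\<close> or \<open>-2/3\<close>.\<close>

lemma three_colours_span_four:
  fixes w :: "nat \<Rightarrow> nat \<Rightarrow> real" and col :: "nat \<Rightarrow> nat"
  assumes norm: "\<And>i. i \<in> I \<Longrightarrow> form (w i) (w i) = 2"
    and same: "\<And>i j. i \<in> I \<Longrightarrow> j \<in> I \<Longrightarrow> col i = col j \<Longrightarrow> form (w i) (w j) \<in> {0, 2, -2}"
    and diff: "\<And>i j. i \<in> I \<Longrightarrow> j \<in> I \<Longrightarrow> col i \<noteq> col j \<Longrightarrow> form (w i) (w j) \<in> {1, -1}"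
    and col: "\<And>i. i \<in> I \<Longrightarrow> col i < 3"
    and p: "p \<in> I" and q: "q \<in> I" and pq: "col p \<noteq> col q"
  obtains x y a b where
    "\<And>i t. i \<in> I \<Longrightarrow> form x t = 0 \<Longrightarrow> form y t = 0 \<Longrightarrow> form a t = 0 \<Longrightarrow> form b t = 0 \<Longrightarrow>
       form (w i) t = 0"
proof -
  define x where "x = w p"
  define y where "y = form (w p) (w q) *\<^sub>f w q"
  have xx: "form x x = 2" using norm p by (simp add: x_def)
  have yy: "form y y = 2" using norm[OF q] diff[OF p q pq] by (auto simp: y_def form_simps)
  have xy: "form x y = 1" using diff[OF p q pq] by (auto simp: x_def y_def form_simps)
  define s where "s i = (if col i = col p then form (w i) y
    else if col i = col q then form (w i) x else - form (w i) x)" for i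
  have s: "s i \<in> {1, -1}" if "i \<in> I" for i
    using diff[OF that p] diff[OF that q] diff[OF p q pq] pq by (auto simp: s_def x_def y_def form_simps)
  define z where "z i = s i *\<^sub>f w i" for i
  have zz: "form (z i) (z i) = 2" if "i \<in> I" for i
    using s[OF that] norm[OF that] by (auto simp: z_def form_simps)
  have z_same: "form (z i) (z j) \<in> {0, 2, -2}" if "i \<in> I" "j \<in> I" "col i = col j" for i j
    using s[OF that(1)] s[OF that(2)] same[OF that] by (auto simp: z_def form_simps)
  have z_diff: "form (z i) (z j) \<in> {1, -1}" if "i \<in> I" "j \<in> I" "col i \<noteq> col j" for i j
    using s[OF that(1)] s[OF that(2)] diff[OF that] by (auto simp: z_def form_simps)
  have zx_p: "form (z i) x \<in> {0, 2, -2}" "form (z i) y = 1" if "i \<in> I" "col i = col p" for i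
    using s[OF that(1)] same[OF that(1) p] that by (auto simp: z_def form_simps x_def s_def)
  have zx_q: "form (z i) x = 1" "form (z i) y \<in> {0, 2, -2}" if "i \<in> I" "col i = col q" for i
    using s[OF that(1)] same[OF that(1) q] diff[OF p q pq] pq that
    by (auto simp: z_def form_simps y_def s_def)
  have zx_r: "form (z i) x = -1" "form (z i) y \<in> {1, -1}"
    if "i \<in> I" "col i \<noteq> col p" "col i \<noteq> col q" for i
    using s[OF that(1)] diff[OF that(1) q] diff[OF p q pq] pq that
    by (auto simp: z_def form_simps y_def s_def)
  \<comment> \<open>the component of \<open>z i\<close> orthogonal to \<open>x\<close> and \<open>y\<close>, whose Gram matrix has inverse \<open>(1/3)\<close> times that with rows \<open>(2,-1)\<close> and \<open>(-1,2)\<close>\<close>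
  define r where "r i = z i - ((2 * form (z i) x - form (z i) y) / 3) *\<^sub>f x
      - ((2 * form (z i) y - form (z i) x) / 3) *\<^sub>f y" for i
  have rr: "form (r i) (r j) = form (z i) (z j) - (2 * form (z i) x * form (z j) x
      + 2 * form (z i) y * form (z j) y - form (z i) x * form (z j) y - form (z i) y * form (z j) x) / 3"
    for i j
    unfolding r_def
    by (simp add: form_simps xx yy xy form_commute[of y x] form_commute[of x "z j"] form_commute[of y "z j"])
       (simp add: field_simps)
  define R where "R = {i \<in> I. (form (z i) x, form (z i) y) =
      (if col i = col p then (0, 1) else if col i = col q then (1, 0) else (-1, -1))}"
  have R: "form (z i) x = (if col i = col p then 0 else if col i = col q then 1 else -1)"
    "form (z i) y = (if col i = col p then 1 else if col i = col q then 0 else -1)" "i \<in> I"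
    if "i \<in> R" for i
    using that by (auto simp: R_def split: if_splits)
  have r_norm: "form (r i) (r i) = 4/3" if "i \<in> R" for i
    using R[OF that] zz pq by (simp add: rr)
  have r_inner: "form (r i) (r j) \<in> {4/3, -2/3}" if ij: "i \<in> R" "j \<in> R" for i j
  proof (cases "col i = col j")
    case True
    \<comment> \<open>Cauchy--Schwarz rules out the value \<open>-8/3\<close>, which opposite vectors of the same colour would give.\<close>
    have "\<bar>form (r i) (r j)\<bar> \<le> 4/3" using form_abs_le r_norm ij by blast
    moreover have "form (z i) x = form (z j) x" "form (z i) y = form (z j) y"
      using R(1,2)[OF ij(1)] R(1,2)[OF ij(2)] True by simp_all
    moreover have "(form (z j) x, form (z j) y) \<in> {(0, 1), (1, 0), (-1, -1)}"
      using R(1,2)[OF ij(2)] by simp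
    ultimately show ?thesis
      using z_same[OF R(3)[OF ij(1)] R(3)[OF ij(2)] True] by (auto simp: rr)
  next
    case False
    have "\<not> (col i \<noteq> col p \<and> col i \<noteq> col q \<and> col j \<noteq> col p \<and> col j \<noteq> col q)"
      using col[OF p] col[OF q] col[OF R(3)[OF ij(1)]] col[OF R(3)[OF ij(2)]] pq False by linarith
    then have "(form (z i) x, form (z i) y) \<noteq> (form (z j) x, form (z j) y)"
      using R(1,2)[OF ij(1)] R(1,2)[OF ij(2)] False pq by auto
    moreover have "(form (z i) x, form (z i) y) \<in> {(0, 1), (1, 0), (-1, -1)}"
      "(form (z j) x, form (z j) y) \<in> {(0, 1), (1, 0), (-1, -1)}"
      using R(1,2)[OF ij(1)] R(1,2)[OF ij(2)] by simp_all
    ultimately show ?thesis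
      using z_diff[OF R(3)[OF ij(1)] R(3)[OF ij(2)] False] by (auto simp: rr)
  qed
  obtain a b where ab: "\<And>v t. v \<in> r ` R \<Longrightarrow> form a t = 0 \<Longrightarrow> form b t = 0 \<Longrightarrow> form v t = 0"
    using triangle_spans_two[of "r ` R"] r_norm r_inner by blast
  show thesis
  proof (rule that[of x y a b])
    fix i t
    assume i: "i \<in> I" and t: "form x t = 0" "form y t = 0" "form a t = 0" "form b t = 0"
    have "form (z i) t = 0"
    proof (cases "i \<in> R")
      case True
      then have "form (r i) t = 0" using ab t by blast
      then show ?thesis using t by (simp add: r_def form_simps)
    next
      case False
      then consider "form (z i) x = 2" | "form (z i) x = -2" | "form (z i) y = 2" | "form (z i) y = -2"
        | "form (z i) x = -1" "form (z i) y = 1"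
        using i zx_p[OF i] zx_q[OF i] zx_r[OF i] by (cases "col i = col p"; cases "col i = col q") (auto simp: R_def)
      then show ?thesis
      proof cases
        case 1
        then have "form (z i - x) (z i - x) = 0"
          by (simp add: form_simps zz[OF i] xx form_commute[of x "z i"])
        then show ?thesis using form_cong_null t by simp
      next
        case 2
        then have "form (z i + x) (z i + x) = 0"
          by (simp add: form_simps zz[OF i] xx form_commute[of x "z i"])
        then have "form (z i + x) t = 0" by (rule form_null)
        then show ?thesis using t by (simp add: form_simps)
      next
        case 3
        then have "form (z i - y) (z i - y) = 0"
          by (simp add: form_simps zz[OF i] yy form_commute[of y "z i"])
        then show ?thesis using form_cong_null t by simp
      next
        case 4
        then have "form (z i + y) (z i + y) = 0"
          by (simp add: form_simps zz[OF i] yy form_commute[of y "z i"])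
        then have "form (z i + y) t = 0" by (rule form_null)
        then show ?thesis using t by (simp add: form_simps)
      next
        case 5
        then have "form (z i - (y - x)) (z i - (y - x)) = 0"
          by (simp add: form_simps zz[OF i] yy xx xy form_commute[of y x]
              form_commute[of x "z i"] form_commute[of y "z i"])
        then have "form (z i) t = form (y - x) t" by (rule form_cong_null)
        then show ?thesis using t by (simp add: form_simps)
      qed
    qed
    then show "form (w i) t = 0" using s[OF i] by (auto simp: z_def form_simps)
  qed
qed

end

section \<open>Pillars over a negative triangle\<close>

locale seidel_form = semidefinite_form +
  assumes diag: "\<And>i. i < n \<Longrightarrow> G i i = 3"
    and off_diag: "\<And>i j. i < n \<Longrightarrow> j < n \<Longrightarrow> i \<noteq> j \<Longrightarrow> G i j \<in> {1, -1}"
begin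

text \<open>The set \<open>I\<close> collects the indices that lie in a pillar, and \<open>col\<close> says in which one. An index outside \<open>I\<close>
lies in the span of the three vectors \<open>u\<close>: its components along them already account for its whole norm 3.\<close>

lemma pillars_span_seven:
  fixes u :: "nat \<Rightarrow> nat \<Rightarrow> real" and col :: "nat \<Rightarrow> nat"
  assumes orthonormal: "\<And>k l. k < 3 \<Longrightarrow> l < 3 \<Longrightarrow> form (u k) (u l) = (if k = l then 1 else 0)"
    and pillar: "\<And>i. i \<in> I \<Longrightarrow> i < n \<and> col i < 3 \<and> form (unit i) (u (col i)) \<in> {1, -1} \<and>
      (\<forall>l<3. l \<noteq> col i \<longrightarrow> form (unit i) (u l) = 0)"
    and base: "\<And>i k. i < n \<Longrightarrow> i \<notin> I \<Longrightarrow> k < 3 \<Longrightarrow> form (unit i) (u k) \<in> {1, -1}"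
    and p: "p \<in> I" and q: "q \<in> I" and pq: "col p \<noteq> col q"
  obtains v :: "nat \<Rightarrow> nat \<Rightarrow> real" where
    "\<And>i t. i < n \<Longrightarrow> (\<And>k. k < 7 \<Longrightarrow> form (v k) t = 0) \<Longrightarrow> form (unit i) t = 0"
proof -
  define g where "g i = form (unit i) (u (col i))" for i
  define w where "w i = unit i - g i *\<^sub>f u (col i)" for i
  have g: "g i \<in> {1, -1}" if "i \<in> I" for i
    using pillar[OF that] by (simp add: g_def)
  have w_same: "form (w i) (w j) = G i j - g i * g j" if "i \<in> I" "j \<in> I" "col i = col j" for i j
    using pillar[OF that(1)] pillar[OF that(2)] that(3)
    by (simp add: w_def form_simps form_unit_unit orthonormal form_commute[of "u (col j)" "unit j"] g_def)
  have w_diff: "form (w i) (w j) = G i j" if "i \<in> I" "j \<in> I" "col i \<noteq> col j" for i j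
    using pillar[OF that(1)] pillar[OF that(2)] that(3)
    by (simp add: w_def form_simps form_unit_unit orthonormal form_commute[of "u (col i)" "unit j"])
  have norm: "form (w i) (w i) = 2" if "i \<in> I" for i
    using w_same[OF that that] g[OF that] diag pillar[OF that] by auto
  have same: "form (w i) (w j) \<in> {0, 2, -2}" if "i \<in> I" "j \<in> I" "col i = col j" for i j
    using w_same[OF that] g[OF that(1)] g[OF that(2)] diag[of i] off_diag[of i j]
      pillar[OF that(1)] pillar[OF that(2)] by (cases "i = j") auto
  have diff: "form (w i) (w j) \<in> {1, -1}" if "i \<in> I" "j \<in> I" "col i \<noteq> col j" for i j
    using w_diff[OF that] off_diag[of i j] pillar[OF that(1)] pillar[OF that(2)] that(3) by auto
  have col: "col i < 3" if "i \<in> I" for i using pillar[OF that] by simp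
  obtain x y a b where span: "\<And>i t. i \<in> I \<Longrightarrow> form x t = 0 \<Longrightarrow> form y t = 0 \<Longrightarrow>
      form a t = 0 \<Longrightarrow> form b t = 0 \<Longrightarrow> form (w i) t = 0"
    using three_colours_span_four[of I w col p q, OF norm same diff col p q pq] by blast
  define v where "v k = [u 0, u 1, u 2, x, y, a, b] ! k" for k
  show thesis
  proof (rule that[of v])
    fix i t assume i: "i < n" and t: "\<And>k. k < 7 \<Longrightarrow> form (v k) t = 0"
    have t': "form (u 0) t = 0" "form (u 1) t = 0" "form (u 2) t = 0" "form x t = 0"
      "form y t = 0" "form a t = 0" "form b t = 0"
      using t[of 0] t[of 1] t[of 2] t[of 3] t[of 4] t[of 5] t[of 6] by (simp_all add: v_def)
    show "form (unit i) t = 0"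
    proof (cases "i \<in> I")
      case True
      have "col i = 0 \<or> col i = 1 \<or> col i = 2" using pillar[OF True] by auto
      then have "form (u (col i)) t = 0" using t' by auto
      moreover have "form (w i) t = 0" using span[OF True] t' by simp
      ultimately show ?thesis by (simp add: w_def form_simps)
    next
      case False
      let ?h = "\<lambda>k. form (unit i) (u k)"
      let ?s = "?h 0 *\<^sub>f u 0 + ?h 1 *\<^sub>f u 1 + ?h 2 *\<^sub>f u 2"
      have "?h 0 * ?h 0 = 1" "?h 1 * ?h 1 = 1" "?h 2 * ?h 2 = 1"
        using base[OF i False, of 0] base[OF i False, of 1] base[OF i False, of 2] by auto
      then have "form (unit i - ?s) (unit i - ?s) = 0"
        using i by (simp add: form_simps form_unit_unit diag orthonormal form_commute[of "u k" "unit i" for k])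
      then have "form (unit i) t = form ?s t" by (rule form_cong_null)
      then show ?thesis using t' by (simp add: form_simps)
    qed
  qed
qed

text \<open>The vectors \<open>f 0\<close>, \<open>f 1\<close>, \<open>f 2\<close> are the three given ones with signs that make their inner products \<open>-1\<close>, and \<open>u k\<close> is the
negated half-sum of the two others. If \<open>s 0\<close>, \<open>s 1\<close>, \<open>s 2\<close> are the inner products of a further vector with the \<open>f\<close>s, then its
inner product with \<open>u k\<close> vanishes or is \<open>\<plusminus>1\<close> according to whether the two other \<open>s\<close> differ or agree.
Among three signs either all agree or exactly one pair does.\<close>

lemma negative_triangle_cases:
  assumes i: "i1 < n" "i2 < n" "i3 < n" "i1 \<noteq> i2" "i1 \<noteq> i3" "i2 \<noteq> i3"
    and neg: "G i1 i2 * G i1 i3 * G i2 i3 = -1"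
  shows "(\<exists>u. form u u = 1 \<and> (\<forall>i<n. form (unit i) u \<in> {1, -1})) \<or>
    (\<exists>v :: nat \<Rightarrow> nat \<Rightarrow> real. \<forall>i t. i < n \<longrightarrow> (\<forall>k<7. form (v k) t = 0) \<longrightarrow> form (unit i) t = 0)"
proof -
  define f where "f k = (if k = 0 then unit i1 else if k = 1 then - G i1 i2 *\<^sub>f unit i2
    else - G i1 i3 *\<^sub>f unit i3)" for k :: nat
  note vals = off_diag[OF i(1,2,4)] off_diag[OF i(1,3,5)] off_diag[OF i(2,3,6)]
  note syms = sym[OF i(2,1)] sym[OF i(3,1)] sym[OF i(3,2)]
  \<comment> \<open>the product of the three signs of the triangle being \<open>-1\<close> is what makes \<open>f 1\<close> and \<open>f 2\<close> fit together\<close>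
  have ff: "form (f k) (f l) = (if k = l then 3 else -1)" if "k < 3" "l < 3" for k l
  proof -
    have "k \<in> {0, 1, 2}" "l \<in> {0, 1, 2}" using that by auto
    then show ?thesis
      using i vals neg by (auto simp: f_def form_simps form_unit_unit diag syms)
  qed
  define u where "u k = (1/2) *\<^sub>f (f k - f 0 - f 1 - f 2)" for k
  have orthonormal: "form (u k) (u l) = (if k = l then 1 else 0)" if "k < 3" "l < 3" for k l
    using that by (simp add: u_def form_simps ff)
  have trichotomy: "(\<forall>k<3. form (unit j) (u k) \<in> {1, -1}) \<or>
    (\<exists>k<3. form (unit j) (u k) \<in> {1, -1} \<and> (\<forall>l<3. l \<noteq> k \<longrightarrow> form (unit j) (u l) = 0))"
    if j: "j < n" for j
  proof -
    define s where "s k = form (unit j) (f k)" for k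
    have u_s: "form (unit j) (u k) = (s k - s 0 - s 1 - s 2) / 2" for k
      by (simp add: u_def s_def form_simps)
    have s0: "s 0 = G j i1" and s1: "s 1 = - G i1 i2 * G j i2" and s2: "s 2 = - G i1 i3 * G j i3"
      using i j by (simp_all add: s_def f_def form_simps form_unit_unit)
    have all: "(\<forall>k<3. P k) \<longleftrightarrow> P 0 \<and> P 1 \<and> P 2" for P :: "nat \<Rightarrow> bool"
      by (auto simp: numeral_3_eq_3 numeral_2_eq_2 less_Suc_eq)
    have ex: "(\<exists>k<3. P k) \<longleftrightarrow> P 0 \<or> P 1 \<or> P 2" for P :: "nat \<Rightarrow> bool"
      by (auto simp: numeral_3_eq_3 numeral_2_eq_2 less_Suc_eq)
    show ?thesis
    proof (cases "j \<in> {i1, i2, i3}")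
      case True
      then have "\<forall>k<3. form (unit j) (u k) \<in> {1, -1}"
        unfolding all u_s s0 s1 s2 using vals neg i by (auto simp: diag syms)
      then show ?thesis ..
    next
      case False
      then have "s 0 = 1 \<or> s 0 = -1" "s 1 = 1 \<or> s 1 = -1" "s 2 = 1 \<or> s 2 = -1"
        using off_diag[OF j i(1)] off_diag[OF j i(2)] off_diag[OF j i(3)] vals
        unfolding s0 s1 s2 by auto
      then show ?thesis unfolding all ex u_s by (elim disjE) simp_all
    qed
  qed
  define I where "I = {j. j < n \<and> \<not> (\<forall>k<3. form (unit j) (u k) \<in> {1, -1})}"
  have "\<exists>k<3. form (unit j) (u k) \<in> {1, -1} \<and> (\<forall>l<3. l \<noteq> k \<longrightarrow> form (unit j) (u l) = 0)"
    if "j \<in> I" for j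
    using trichotomy[of j] that unfolding I_def by blast
  then obtain col where col: "col j < 3" "form (unit j) (u (col j)) \<in> {1, -1}"
      "\<forall>l<3. l \<noteq> col j \<longrightarrow> form (unit j) (u l) = 0" if "j \<in> I" for j
    by metis
  show ?thesis
  proof (cases "\<exists>p\<in>I. \<exists>q\<in>I. col p \<noteq> col q")
    case True
    then obtain p q where pq: "p \<in> I" "q \<in> I" "col p \<noteq> col q" by blast
    have pillar: "j < n \<and> col j < 3 \<and> form (unit j) (u (col j)) \<in> {1, -1} \<and>
      (\<forall>l<3. l \<noteq> col j \<longrightarrow> form (unit j) (u l) = 0)" if "j \<in> I" for j
      using col[OF that] that unfolding I_def by blast
    have base: "form (unit j) (u k) \<in> {1, -1}" if "j < n" "j \<notin> I" "k < 3" for j k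
      using that unfolding I_def by blast
    obtain v :: "nat \<Rightarrow> nat \<Rightarrow> real" where
      "\<And>i t. i < n \<Longrightarrow> (\<And>k. k < 7 \<Longrightarrow> form (v k) t = 0) \<Longrightarrow> form (unit i) t = 0"
      using pillars_span_seven[of u I col p q, OF orthonormal pillar base pq] by blast
    then show ?thesis by blast
  next
    case False
    have "\<exists>k<3. \<forall>j\<in>I. col j = k"
    proof (cases "I = {}")
      case True
      then show ?thesis by (intro exI[of _ 0]) simp
    next
      case ne: False
      then obtain p where "p \<in> I" by blast
      then show ?thesis using False col(1)[of p] by (intro exI[of _ "col p"]) blast
    qed
    then obtain k where k: "k < 3" "\<forall>j\<in>I. col j = k" by blast
    have "form (unit j) (u k) \<in> {1, -1}" if "j < n" for j
      using col(2)[of j] k that by (cases "j \<in> I") (auto simp: I_def)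
    then show ?thesis using orthonormal[OF k(1) k(1)] by auto
  qed
qed

text \<open>With the signs \<open>s i\<close> given by the inner products with \<open>u\<close>, the vectors \<open>w i = s i v\<^sub>i - u\<close> have norm 2, and the
switched inner product is \<open>-1\<close> only if \<open>w i\<close> and \<open>w j\<close> are opposite. Two vectors opposite to the same one
coincide, which forces their indices to be equal because distinct \<open>v\<^sub>i\<close> do not have inner product \<open>\<plusminus>3\<close>.\<close>

lemma unit_vector_matching:
  assumes u: "form u u = 1" "\<forall>i<n. form (unit i) u \<in> {1, -1}"
  obtains s :: "nat \<Rightarrow> real" where "\<And>i. s i \<in> {1, -1}"
    "\<And>i j k. i < n \<Longrightarrow> j < n \<Longrightarrow> k < n \<Longrightarrow> s i * s j * G i j = -1 \<Longrightarrow> s i * s k * G i k = -1 \<Longrightarrow> j = k"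
proof -
  define s where "s i = (if i < n then form (unit i) u else 1)" for i
  define w where "w i = s i *\<^sub>f unit i - u" for i
  have s: "s i \<in> {1, -1}" for i using u by (simp add: s_def)
  have s_sq: "s i * s i = 1" for i using s[of i] by auto
  have ww: "form (w i) (w j) = s i * s j * G i j - 1" if "i < n" "j < n" for i j
    using that u(1) s_sq[of i] s_sq[of j]
    by (simp add: w_def form_simps form_unit_unit form_commute[of u "unit j"] s_def algebra_simps)
  have norm: "form (w i) (w i) = 2" if "i < n" for i
    using that by (simp add: ww diag s_sq)
  show thesis
  proof (rule that[of s])
    fix i j k assume lt: "i < n" "j < n" "k < n"
      and e: "s i * s j * G i j = -1" "s i * s k * G i k = -1"
    have "form (w i + w j) (w i + w j) = 0"
      using lt e ww[of i j] norm by (simp add: form_simps form_commute[of "w j" "w i"])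
    then have "form (w i + w j) (w k) = 0" by (rule form_null)
    then have "s j * s k * G j k = 3"
      using lt e ww[of i k] ww[of j k] by (simp add: form_simps)
    then have "G j k \<notin> {1, -1}" using s[of j] s[of k] by auto
    then show "j = k" using off_diag[OF lt(2,3)] by blast
  qed (rule s)
qed

text \<open>Switch so that the inner products with the vector of index 0 are all 1. Every other pair forms a triangle with index 0, so it has
inner product 1 as well.\<close>

lemma no_negative_triangle_matching:
  assumes no: "\<And>i1 i2 i3. i1 < n \<Longrightarrow> i2 < n \<Longrightarrow> i3 < n \<Longrightarrow> i1 \<noteq> i2 \<Longrightarrow> i1 \<noteq> i3 \<Longrightarrow> i2 \<noteq> i3 \<Longrightarrow>
      G i1 i2 * G i1 i3 * G i2 i3 \<noteq> -1"
  obtains s :: "nat \<Rightarrow> real" where "\<And>i. s i \<in> {1, -1}"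
    "\<And>i j. i < n \<Longrightarrow> j < n \<Longrightarrow> s i * s j * G i j \<noteq> -1"
proof -
  define s where "s i = (if i = 0 \<or> n \<le> i then 1 else G 0 i)" for i
  have s: "s i \<in> {1, -1}" for i using off_diag[of 0 i] by (auto simp: s_def)
  show thesis
  proof (rule that[of s])
    fix i j assume lt: "i < n" "j < n"
    show "s i * s j * G i j \<noteq> -1"
    proof (cases "i = j \<or> i = 0 \<or> j = 0")
      case True
      then show ?thesis using lt s[of i] s[of j] off_diag[of 0 i] off_diag[of 0 j] sym[of i 0]
        by (auto simp: s_def diag)
    next
      case False
      then show ?thesis using lt no[of 0 i j] by (simp add: s_def)
    qed
  qed (rule s)
qed

end

section \<open>From eigenvalues to semidefiniteness\<close>

text \<open>Let \<open>t0\<close> be the least \<open>t \<ge> 0\<close> for which \<open>G + tI\<close> is semidefinite. If \<open>t0 > 0\<close>, then \<open>H = G + t0 I\<close> is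
semidefinite and invertible, and this already gives a uniform bound \<open>x \<bullet> x \<le> c (x \<bullet> Hx)\<close>: apply the Cauchy--Schwarz
inequality for \<open>H\<close> to \<open>x\<close> and \<open>y = H\<^sup>-\<^sup>1 x\<close>. Hence \<open>t0\<close> could be decreased by \<open>1/c\<close>. This replaces a
diagonalisation of \<open>G\<close>.\<close>

lemma nonneg_of_no_negative_eigenvalue:
  fixes G :: "nat \<Rightarrow> nat \<Rightarrow> real"
  assumes sym: "\<And>i j. i < n \<Longrightarrow> j < n \<Longrightarrow> G i j = G j i"
    and det: "\<And>t. t > 0 \<Longrightarrow> det (mat n n (\<lambda>(i, j). G i j + (if i = j then t else 0))) \<noteq> 0"
  shows "0 \<le> (\<Sum>i<n. \<Sum>j<n. x i * G i j * x j)"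
proof -
  define Q where "Q x = (\<Sum>i<n. \<Sum>j<n. x i * G i j * x j)" for x :: "nat \<Rightarrow> real"
  define N where "N x = (\<Sum>i<n. (x i)\<^sup>2)" for x :: "nat \<Rightarrow> real"
  define H where "H t i j = G i j + (if i = j then t else 0)" for t i j
  have N_nonneg: "0 \<le> N x" for x by (simp add: N_def sum_nonneg)
  have H_form: "(\<Sum>i<n. \<Sum>j<n. x i * H t i j * x j) = Q x + t * N x" for t x
    by (simp add: H_def Q_def N_def algebra_simps sum.distrib sum_distrib_left power2_eq_square
        if_distrib[of "\<lambda>a. _ * a"] if_distrib[of "\<lambda>a. a * _"] cong: if_cong)
  have bound: "\<bar>\<Sum>i<n. \<Sum>j<n. x i * C i j * x j\<bar> \<le> (\<Sum>i<n. \<Sum>j<n. \<bar>C i j\<bar>) * N x" for C x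
  proof -
    have le: "\<bar>x i * C i j * x j\<bar> \<le> \<bar>C i j\<bar> * N x" if "i < n" "j < n" for i j
    proof -
      have "(x i)\<^sup>2 \<le> N x" "(x j)\<^sup>2 \<le> N x"
        using that unfolding N_def by (auto intro!: member_le_sum)
      moreover have "0 \<le> (\<bar>x i\<bar> - \<bar>x j\<bar>)\<^sup>2" by simp
      ultimately have "\<bar>x i\<bar> * \<bar>x j\<bar> \<le> N x" by (simp add: power2_diff)
      then have "\<bar>C i j\<bar> * (\<bar>x i\<bar> * \<bar>x j\<bar>) \<le> \<bar>C i j\<bar> * N x"
        by (rule mult_left_mono) simp
      then show ?thesis by (simp add: abs_mult mult.commute mult.left_commute)
    qed
    have "\<bar>\<Sum>i<n. \<Sum>j<n. x i * C i j * x j\<bar> \<le> (\<Sum>i<n. \<Sum>j<n. \<bar>x i * C i j * x j\<bar>)"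
      by (rule order_trans[OF sum_abs]) (intro sum_mono sum_abs)
    also have "\<dots> \<le> (\<Sum>i<n. \<Sum>j<n. \<bar>C i j\<bar> * N x)"
      by (intro sum_mono) (use le in auto)
    finally show ?thesis by (simp add: sum_distrib_right)
  qed
  define T where "T = {t. 0 \<le> t \<and> (\<forall>x. 0 \<le> Q x + t * N x)}"
  have "(\<Sum>i<n. \<Sum>j<n. \<bar>G i j\<bar>) \<in> T"
    using bound[of _ G] by (auto simp: T_def Q_def[symmetric] abs_le_iff intro!: sum_nonneg)
      (smt (verit))
  then have T_ne: "T \<noteq> {}" by blast
  have T_bdd: "bdd_below T" by (rule bdd_belowI[of _ 0]) (simp add: T_def)
  define t0 where "t0 = Inf T"
  have t0: "0 \<le> t0" unfolding t0_def by (rule cInf_greatest[OF T_ne]) (simp add: T_def)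
  have t0_nonneg: "0 \<le> Q x + t0 * N x" for x
  proof (cases "N x = 0")
    case True
    then show ?thesis using T_ne by (auto simp: T_def dest: spec[of _ x])
  next
    case False
    then have N: "0 < N x" using N_nonneg[of x] by simp
    have "- Q x / N x \<le> t0"
      unfolding t0_def
    proof (rule cInf_greatest[OF T_ne])
      fix t assume "t \<in> T"
      then have "0 \<le> Q x + t * N x" by (simp add: T_def)
      then show "- Q x / N x \<le> t" using N by (simp add: field_simps)
    qed
    then show ?thesis using N by (simp add: field_simps)
  qed
  have "t0 = 0"
  proof (rule ccontr)
    assume "t0 \<noteq> 0"
    then have pos: "t0 > 0" using t0 by simp
    interpret H: semidefinite_form n "H t0"
    proof
      show "H t0 i j = H t0 j i" if "i < n" "j < n" for i j using that sym by (simp add: H_def)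
      show "0 \<le> (\<Sum>i<n. \<Sum>j<n. x i * H t0 i j * x j)" for x using t0_nonneg by (simp add: H_form)
    qed
    have Hxx: "H.form x x = Q x + t0 * N x" for x by (simp add: H.form_def H_form)
    let ?M = "mat n n (\<lambda>(i, j). H t0 i j)"
    have "det ?M \<noteq> 0" using det[OF pos] by (simp add: H_def)
    then obtain C where C: "C \<in> carrier_mat n n" "?M * C = 1\<^sub>m n"
      using det_non_zero_imp_unit[of ?M n "()"] by (auto simp: Units_def ring_mat_def)
    have inv: "(\<Sum>j<n. H t0 i j * C $$ (j, k)) = (if i = k then 1 else 0)" if "i < n" "k < n" for i k
    proof -
      have "(?M * C) $$ (i, k) = (\<Sum>j<n. H t0 i j * C $$ (j, k))"
        using that C(1) by (simp add: scalar_prod_def atLeast0LessThan)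
      then show ?thesis using C(2) that by simp
    qed
    define c where "c = (\<Sum>i<n. \<Sum>j<n. \<bar>C $$ (i, j)\<bar>) + 1"
    have c: "c > 0" unfolding c_def by (simp add: add_nonneg_pos sum_nonneg)
    have strict: "N x \<le> c * (Q x + t0 * N x)" for x
    proof (cases "N x = 0")
      case True
      then show ?thesis using c t0_nonneg[of x] by (simp add: zero_le_mult_iff)
    next
      case False
      then have N: "0 < N x" using N_nonneg[of x] by simp
      define y where "y j = (\<Sum>k<n. C $$ (j, k) * x k)" for j
      have Hy: "(\<Sum>j<n. H t0 i j * y j) = x i" if "i < n" for i
      proof -
        have "(\<Sum>j<n. H t0 i j * y j) = (\<Sum>k<n. (\<Sum>j<n. H t0 i j * C $$ (j, k)) * x k)"
          unfolding y_def sum_distrib_left sum_distrib_right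
          by (subst sum.swap) (simp add: mult.assoc)
        also have "\<dots> = (\<Sum>k<n. if k = i then x k else 0)"
          by (intro sum.cong refl) (use inv that in auto)
        finally show ?thesis using that by simp
      qed
      have form_y: "H.form z y = (\<Sum>i<n. z i * x i)" for z
        unfolding H.form_def by (intro sum.cong refl) (simp add: Hy mult.assoc sum_distrib_left[symmetric])
      have "H.form x y = N x" by (simp add: form_y N_def power2_eq_square)
      moreover have "H.form y y \<le> c * N x"
      proof -
        have "H.form y y = (\<Sum>i<n. \<Sum>j<n. x i * C $$ (i, j) * x j)"
          by (simp add: form_y y_def sum_distrib_left sum_distrib_right mult.commute mult.left_commute)
        also have "\<dots> \<le> (\<Sum>i<n. \<Sum>j<n. \<bar>C $$ (i, j)\<bar>) * N x"
          using bound[of x "\<lambda>i j. C $$ (i, j)"] by linarith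
        also have "\<dots> \<le> c * N x" using N by (simp add: c_def)
        finally show ?thesis .
      qed
      moreover have "0 \<le> H.form x x" by (rule H.form_nonneg)
      ultimately have "(N x)\<^sup>2 \<le> H.form x x * (c * N x)"
        using H.form_Cauchy_Schwarz[of x y] by (metis mult_left_mono order_trans)
      then have "N x * N x \<le> N x * (c * H.form x x)" by (simp add: power2_eq_square mult.commute mult.left_commute)
      then show ?thesis using N by (simp add: Hxx)
    qed
    define t1 where "t1 = max 0 (t0 - 1 / c)"
    have "t1 \<in> T"
    proof -
      have "0 \<le> Q x + t1 * N x" for x
      proof -
        have "0 \<le> Q x + (t0 - 1 / c) * N x" using strict[of x] c by (simp add: field_simps)
        also have "\<dots> \<le> Q x + t1 * N x" using N_nonneg[of x] by (simp add: t1_def mult_right_mono)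
        finally show ?thesis .
      qed
      then show ?thesis by (simp add: T_def t1_def)
    qed
    then have "t0 \<le> t1" unfolding t0_def using T_bdd by (rule cInf_lower)
    then show False using pos c by (simp add: t1_def max_def split: if_splits)
  qed
  then show ?thesis using t0_nonneg[of x] by (simp add: Q_def)
qed

section \<open>Rank, independent columns and kernels\<close>

text \<open>Columns are selected by a function on indices, so that repeated columns, which the set of columns of a matrix cannot see, are handled correctly.\<close>

lemma (in vec_space) le_rank_iff_independent_columns:
  assumes A: "A \<in> carrier_mat n nc"
  shows "k \<le> rank A \<longleftrightarrow> (\<exists>p. (\<forall>l<k. p l < nc) \<and>
    (\<forall>c. (\<forall>i<n. (\<Sum>l<k. A $$ (i, p l) * c l) = 0) \<longrightarrow> (\<forall>l<k. c l = 0)))"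
    (is "_ \<longleftrightarrow> (\<exists>p. ?lt p \<and> ?ind p)")
proof
  assume k: "k \<le> rank A"
  have "lin_indpt {}" by (auto simp: lin_dep_def)
  then obtain U where U: "maximal U (\<lambda>T. T \<subseteq> set (cols A) \<and> lin_indpt T)"
    using maximal_exists_superset[of "set (cols A)" "\<lambda>T. T \<subseteq> set (cols A) \<and> lin_indpt T" "{}"]
    by auto
  then have U_cols: "U \<subseteq> set (cols A)" and U_ind: "lin_indpt U" by (auto simp: maximal_def)
  have "finite U" using U_cols finite_subset by blast
  moreover have "k \<le> card U" using rank_card_indpt[OF A U] k by simp
  ultimately obtain W where W: "W \<subseteq> U" "card W = k" "finite W"
    by (meson obtain_subset_with_card_n)
  obtain ws where ws: "set ws = W" "distinct ws" using finite_distinct_list[OF W(3)] by blast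
  have len: "length ws = k" using W(2) ws distinct_card by metis
  have "\<exists>j<nc. col A j = ws ! l" if "l < k" for l
  proof -
    have "ws ! l \<in> set (cols A)" using that len ws(1) W(1) U_cols nth_mem by blast
    then show ?thesis using A by (auto simp: cols_def)
  qed
  then obtain p where p: "p l < nc" "col A (p l) = ws ! l" if "l < k" for l by metis
  define M where "M = mat n k (\<lambda>(i, l). A $$ (i, p l))"
  have M: "M \<in> carrier_mat n k" by (simp add: M_def)
  have col_M: "col M l = ws ! l" if "l < k" for l
  proof -
    have "col M l = col A (p l)" using that p(1)[OF that] A by (intro eq_vecI) (auto simp: M_def)
    then show ?thesis using p(2)[OF that] by simp
  qed
  have cols_M: "cols M = ws"
    by (rule nth_equalityI) (use M len col_M in \<open>auto simp: cols_length\<close>)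
  have ind: "lin_indpt (set (cols M))"
    using U_ind W(1) ws(1) cols_M subset_li_is_li by auto
  have "?ind p"
  proof (intro allI impI)
    fix c l assume c: "\<forall>i<n. (\<Sum>l<k. A $$ (i, p l) * c l) = 0" and l: "l < k"
    have "M *\<^sub>v vec k c = 0\<^sub>v n"
      by (rule eq_vecI) (use c in \<open>auto simp: M_def scalar_prod_def atLeast0LessThan\<close>)
    then have "vec k c = 0\<^sub>v k"
      using lin_depI[OF M, of "vec k c"] ind cols_M ws(2) by auto
    then show "c l = 0" using l by (metis index_vec index_zero_vec(1))
  qed
  then show "\<exists>p. ?lt p \<and> ?ind p" using p(1) by blast
next
  assume "\<exists>p. ?lt p \<and> ?ind p"
  then obtain p where p: "?lt p" and ind: "?ind p" by blast
  define M where "M = mat n k (\<lambda>(i, l). A $$ (i, p l))"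
  have M: "M \<in> carrier_mat n k" by (simp add: M_def)
  have col_M: "col M l = col A (p l)" if "l < k" for l
    using that p A by (intro eq_vecI) (auto simp: M_def)
  have "distinct (cols M)"
    unfolding distinct_conv_nth
  proof (intro allI impI)
    fix l l' assume l: "l < length (cols M)" "l' < length (cols M)" "l \<noteq> l'"
    then have lk: "l < k" "l' < k" using M by auto
    show "cols M ! l \<noteq> cols M ! l'"
    proof
      assume "cols M ! l = cols M ! l'"
      then have eq: "col M l = col M l'" using l by (simp add: cols_nth)
      define c :: "nat \<Rightarrow> 'a" where "c j = (if j = l then 1 else if j = l' then -1 else 0)" for j
      have "(\<Sum>j<k. A $$ (i, p j) * c j) = 0" if i: "i < n" for i
      proof -
        have "(\<Sum>j<k. A $$ (i, p j) * c j) = (\<Sum>j<k. (if j = l then A $$ (i, p l) else 0) -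
            (if j = l' then A $$ (i, p l') else 0))"
          by (rule sum.cong) (use l(3) in \<open>auto simp: c_def\<close>)
        also have "\<dots> = M $$ (i, l) - M $$ (i, l')"
          using lk i by (simp add: sum_subtractf M_def)
        also have "\<dots> = col M l $ i - col M l' $ i" using lk i M by auto
        finally show ?thesis using eq by simp
      qed
      then have "c l = 0" using ind lk by blast
      then show False by (simp add: c_def)
    qed
  qed
  have "lin_indpt (set (cols M))"
  proof
    assume "lin_dep (set (cols M))"
    then obtain v where v: "v \<in> carrier_vec k" "v \<noteq> 0\<^sub>v k" "M *\<^sub>v v = 0\<^sub>v n"
      using lin_depE[OF M] \<open>distinct (cols M)\<close> by blast
    have "(\<Sum>l<k. A $$ (i, p l) * v $ l) = 0" if "i < n" for i
    proof -
      have "(M *\<^sub>v v) $ i = (\<Sum>l<k. A $$ (i, p l) * v $ l)"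
        using that v(1) by (simp add: M_def scalar_prod_def atLeast0LessThan)
      then show ?thesis using v(3) that by simp
    qed
    then have "\<forall>l<k. v $ l = 0" using ind[rule_format, of "\<lambda>l. v $ l"] by blast
    then show False using v(1,2) by (auto intro: eq_vecI)
  qed
  moreover have "set (cols M) \<subseteq> set (cols A)"
  proof
    fix x assume "x \<in> set (cols M)"
    then obtain l where "l < k" "x = col M l" using M by (auto simp: cols_def)
    then show "x \<in> set (cols A)" using col_M p A by (auto simp: cols_def)
  qed
  ultimately have "card (set (cols M)) \<le> rank A" using rank_ge_card_indpt[OF A] by blast
  moreover have "card (set (cols M)) = k"
    using \<open>distinct (cols M)\<close> M distinct_card cols_length by fastforce
  ultimately show "k \<le> rank A" by simp
qed

lemma underdetermined_system:
  fixes a :: "nat \<Rightarrow> nat \<Rightarrow> 'a :: field"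
  obtains c l where "l \<le> r" "c l \<noteq> 0" "\<And>k. k < r \<Longrightarrow> (\<Sum>l\<le>r. a k l * c l) = 0"
proof -
  let ?M = "mat (Suc r) (Suc r) (\<lambda>(k, l). if k < r then a k l else 0)"
  have "?M = mat\<^sub>r (Suc r) (Suc r) (\<lambda>k. if k = r then 0\<^sub>v (Suc r) else vec (Suc r) (a k))"
    by (rule eq_matI) auto
  then have "det ?M = 0"
    using det_row_0[of r "Suc r" "\<lambda>k. vec (Suc r) (a k)"] by auto
  then obtain v where v: "v \<in> carrier_vec (Suc r)" "v \<noteq> 0\<^sub>v (Suc r)" "?M *\<^sub>v v = 0\<^sub>v (Suc r)"
    using det_0_iff_vec_prod_zero[of ?M "Suc r"] by auto
  have "\<exists>l<Suc r. v $ l \<noteq> 0"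
  proof (rule ccontr)
    assume "\<not> ?thesis"
    then have "v = 0\<^sub>v (Suc r)" using v(1) by (intro eq_vecI) auto
    then show False using v(2) by simp
  qed
  then obtain l where l: "l < Suc r" "v $ l \<noteq> 0" by blast
  have "(\<Sum>l\<le>r. a k l * v $ l) = 0" if "k < r" for k
  proof -
    have "(?M *\<^sub>v v) $ k = (\<Sum>l\<le>r. a k l * v $ l)"
      using that v(1) by (simp add: scalar_prod_def atLeast0LessThan lessThan_Suc_atMost)
    then show ?thesis using v(3) that by simp
  qed
  then show thesis using that[of l "\<lambda>l. v $ l"] l by auto
qed

text \<open>An upper bound for the rank only requires \<open>r\<close> linear functionals \<open>m k\<close> whose common kernel lies in the kernel
of \<open>A\<close>.\<close>

lemma (in vec_space) rank_le_of_kernel: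
  assumes A: "A \<in> carrier_mat n nc"
    and ker: "\<And>x i. (\<And>k. k < r \<Longrightarrow> (\<Sum>j<nc. m k j * x j) = 0) \<Longrightarrow> i < n \<Longrightarrow>
      (\<Sum>j<nc. A $$ (i, j) * x j) = 0"
  shows "rank A \<le> r"
proof (rule ccontr)
  assume "\<not> rank A \<le> r"
  then have "Suc r \<le> rank A" by simp
  then obtain p where p: "\<And>l. l < Suc r \<Longrightarrow> p l < nc"
    and ind: "\<And>c l. (\<And>i. i < n \<Longrightarrow> (\<Sum>l<Suc r. A $$ (i, p l) * c l) = 0) \<Longrightarrow> l < Suc r \<Longrightarrow> c l = 0"
    unfolding le_rank_iff_independent_columns[OF A] by metis
  \<comment> \<open>more than \<open>r\<close> independent columns would carry a vector that is killed by all \<open>r\<close> functionals\<close>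
  obtain c l where c: "l \<le> r" "c l \<noteq> 0" "\<And>k. k < r \<Longrightarrow> (\<Sum>l\<le>r. m k (p l) * c l) = 0"
    by (rule underdetermined_system[of r "\<lambda>k l. m k (p l)"]) blast
  define x where "x j = (\<Sum>l\<le>r. if p l = j then c l else 0)" for j
  have x: "(\<Sum>j<nc. b j * x j) = (\<Sum>l\<le>r. b (p l) * c l)" for b
  proof -
    have "(\<Sum>j<nc. b j * x j) = (\<Sum>l\<le>r. \<Sum>j<nc. if j = p l then b j * c l else 0)"
      unfolding x_def sum_distrib_left by (subst sum.swap) (intro sum.cong refl, auto)
    also have "\<dots> = (\<Sum>l\<le>r. b (p l) * c l)"
      using p by (intro sum.cong refl) (auto simp: less_Suc_eq_le)
    finally show ?thesis .
  qed
  have "(\<Sum>l<Suc r. A $$ (i, p l) * c l) = 0" if "i < n" for i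
    using ker[of x i] c(3) that unfolding x lessThan_Suc_atMost by blast
  then show False using ind[of c l] c(1,2) by simp
qed

section \<open>Switching as a signed relabelling\<close>

lemma conj_signed_perm:
  fixes S :: "real mat"
  assumes S: "S \<in> carrier_mat n n" and \<pi>: "\<And>i. i < n \<Longrightarrow> \<pi> i < n"
    and P: "P \<in> carrier_mat n n"
      "\<And>k i. k < n \<Longrightarrow> i < n \<Longrightarrow> P $$ (k, i) = (if k = \<pi> i then s i else 0)"
    and ij: "i < n" "j < n"
  shows "(P\<^sup>T * S * P) $$ (i, j) = s i * s j * S $$ (\<pi> i, \<pi> j)"
proof -
  have left: "(P\<^sup>T * S) $$ (i, l) = s i * S $$ (\<pi> i, l)" if l: "l < n" for l
  proof -
    have "(P\<^sup>T * S) $$ (i, l) = (\<Sum>k<n. P $$ (k, i) * S $$ (k, l))"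
      using S P(1) ij l by (simp add: scalar_prod_def atLeast0LessThan)
    also have "\<dots> = (\<Sum>k<n. if k = \<pi> i then s i * S $$ (\<pi> i, l) else 0)"
      by (intro sum.cong refl) (use P(2) ij in auto)
    finally show ?thesis using \<pi> ij by simp
  qed
  have "(P\<^sup>T * S * P) $$ (i, j) = (\<Sum>l<n. (P\<^sup>T * S) $$ (i, l) * P $$ (l, j))"
    using S P(1) ij by (subst index_mult_mat) (simp_all add: scalar_prod_def atLeast0LessThan)
  also have "\<dots> = (\<Sum>l<n. if l = \<pi> j then s i * s j * S $$ (\<pi> i, \<pi> j) else 0)"
  proof (intro sum.cong refl)
    fix l assume "l \<in> {..<n}"
    then have l: "l < n" by simp
    show "(P\<^sup>T * S) $$ (i, l) * P $$ (l, j) = (if l = \<pi> j then s i * s j * S $$ (\<pi> i, \<pi> j) else 0)"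
      unfolding left[OF l] P(2)[OF l ij(2)] by simp
  qed
  finally show ?thesis using \<pi> ij by simp
qed

lemma seidel_mat_carrier: "seidel_mat S \<Longrightarrow> dim_row S = n \<Longrightarrow> S \<in> carrier_mat n n"
  unfolding seidel_mat_def square_mat.simps by (elim conjE) (rule carrier_matI, simp_all only:)

definition switches_to :: "real mat \<Rightarrow> (nat \<Rightarrow> nat) \<Rightarrow> (nat \<Rightarrow> real) \<Rightarrow> real mat \<Rightarrow> bool" where
  "switches_to S \<pi> s S' \<longleftrightarrow> dim_row S' = dim_row S \<and>
     bij_betw \<pi> {..<dim_row S} {..<dim_row S} \<and> (\<forall>i<dim_row S. s i \<in> {1, -1}) \<and>
     (\<forall>i<dim_row S. \<forall>j<dim_row S. S' $$ (i, j) = s i * s j * S $$ (\<pi> i, \<pi> j))"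

lemma switching_rel_iff:
  "(S, S') \<in> switching_rel \<longleftrightarrow> seidel_mat S \<and> seidel_mat S' \<and> (\<exists>\<pi> s. switches_to S \<pi> s S')"
proof
  assume "(S, S') \<in> switching_rel"
  then obtain P where S: "seidel_mat S" "seidel_mat S'"
    and P: "signed_perm_mat (dim_row S) P" and eq: "P\<^sup>T * S * P = S'"
    by (auto simp: switching_rel_def)
  define n where "n = dim_row S"
  have Sc: "S \<in> carrier_mat n n" using seidel_mat_carrier[OF S(1) n_def[symmetric]] .
  have Pc: "P \<in> carrier_mat n n" using P by (simp add: signed_perm_mat_def n_def)
  note P' = P[unfolded signed_perm_mat_def n_def[symmetric], THEN conjunct2]
  note entries = P'[THEN conjunct1]
  note unique_row = P'[THEN conjunct2, THEN conjunct1, rule_format]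
  note unique_col = P'[THEN conjunct2, THEN conjunct2, rule_format]
  have "\<forall>i<n. \<exists>k. k < n \<and> P $$ (k, i) \<noteq> 0" using unique_col by blast
  then obtain \<pi> where \<pi>: "\<pi> i < n" "P $$ (\<pi> i, i) \<noteq> 0" if "i < n" for i by metis
  have col: "k = \<pi> i" if "k < n" "i < n" "P $$ (k, i) \<noteq> 0" for k i
    using unique_col[OF that(2)] \<pi>[OF that(2)] that by blast
  have row: "i = j" if "i < n" "j < n" "\<pi> i = \<pi> j" for i j
    using unique_row[OF \<pi>(1)[OF that(1)]] \<pi>(2)[OF that(1)] \<pi>(2)[OF that(2)] that by auto
  define s where "s i = P $$ (\<pi> i, i)" for i
  have s: "s i \<in> {1, -1}" if "i < n" for i
  proof -
    have "P $$ (\<pi> i, i) \<in> {0, 1, -1}"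
      using entries \<pi>(1)[OF that] that by blast
    then show ?thesis using \<pi>(2)[OF that] by (simp add: s_def)
  qed
  have "inj_on \<pi> {..<n}" using row by (auto intro: inj_onI)
  moreover have "\<pi> ` {..<n} \<subseteq> {..<n}" using \<pi> by auto
  ultimately have "bij_betw \<pi> {..<n} {..<n}" by (simp add: bij_betw_def endo_inj_surj)
  moreover have "S' $$ (i, j) = s i * s j * S $$ (\<pi> i, \<pi> j)" if "i < n" "j < n" for i j
    unfolding eq[symmetric]
    by (rule conj_signed_perm[OF Sc \<pi>(1) Pc _ that]) (use col in \<open>auto simp: s_def\<close>)
  moreover have "dim_row S' = n" using eq Pc by auto
  ultimately have "switches_to S \<pi> s S'" using s unfolding switches_to_def n_def[symmetric] by simp
  then show "seidel_mat S \<and> seidel_mat S' \<and> (\<exists>\<pi> s. switches_to S \<pi> s S')" using S by blast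
next
  assume "seidel_mat S \<and> seidel_mat S' \<and> (\<exists>\<pi> s. switches_to S \<pi> s S')"
  then obtain \<pi> s where S: "seidel_mat S" "seidel_mat S'" and sw: "switches_to S \<pi> s S'" by blast
  define n where "n = dim_row S"
  have Sc: "S \<in> carrier_mat n n" using seidel_mat_carrier[OF S(1) n_def[symmetric]] .
  have S'c: "S' \<in> carrier_mat n n"
    using seidel_mat_carrier[OF S(2), of n] sw by (simp add: n_def switches_to_def)
  note sw' = sw[unfolded switches_to_def n_def[symmetric]]
  have \<pi>: "\<pi> i < n" if "i < n" for i using sw' that bij_betwE by blast
  have inj: "i = j" if "i < n" "j < n" "\<pi> i = \<pi> j" for i j
    using sw' that unfolding bij_betw_def inj_on_def by blast
  have surj: "\<exists>i<n. \<pi> i = k" if "k < n" for k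
    using sw' that unfolding bij_betw_def by (metis imageE lessThan_iff)
  have s: "s i = 1 \<or> s i = -1" if "i < n" for i using sw' that by blast
  define P where "P = mat n n (\<lambda>(k, i). if k = \<pi> i then s i else 0)"
  have Pc: "P \<in> carrier_mat n n" by (simp add: P_def)
  have Pkl: "P $$ (k, i) = (if k = \<pi> i then s i else 0)" if "k < n" "i < n" for k i
    using that by (simp add: P_def)
  have nz: "P $$ (k, i) \<noteq> 0 \<longleftrightarrow> k = \<pi> i" if "k < n" "i < n" for k i
    using s[OF that(2)] that by (auto simp: Pkl)
  have "signed_perm_mat n P"
    unfolding signed_perm_mat_def
  proof (intro conjI allI impI)
    show "P $$ (i, j) \<in> {0, 1, -1}" if "i < n" "j < n" for i j
      using s[OF that(2)] that by (auto simp: Pkl)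
    show "\<exists>!j. j < n \<and> P $$ (i, j) \<noteq> 0" if "i < n" for i
      using surj[OF that] inj nz[OF that] by metis
    show "\<exists>!i. i < n \<and> P $$ (i, j) \<noteq> 0" if "j < n" for j
      using \<pi>[OF that] nz[OF _ that] by metis
  qed (rule Pc)
  moreover have "P\<^sup>T * S * P = S'"
  proof (rule eq_matI)
    fix i j assume "i < dim_row S'" "j < dim_col S'"
    then have ij: "i < n" "j < n" using S'c by auto
    show "(P\<^sup>T * S * P) $$ (i, j) = S' $$ (i, j)"
      using conj_signed_perm[OF Sc \<pi> Pc Pkl ij] sw' ij by simp
  qed (use Pc S'c in auto)
  ultimately show "(S, S') \<in> switching_rel"
    using S by (auto simp: switching_rel_def n_def)
qed

lemma switches_to_refl: "switches_to S id (\<lambda>_. 1) S"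
  by (simp add: switches_to_def)

lemma switches_to_sym:
  assumes "switches_to S \<pi> s S'"
  shows "switches_to S' (inv_into {..<dim_row S} \<pi>) (s \<circ> inv_into {..<dim_row S} \<pi>) S"
proof -
  let ?A = "{..<dim_row S}"
  let ?\<rho> = "inv_into ?A \<pi>"
  have bij: "bij_betw \<pi> ?A ?A" and s: "\<And>i. i < dim_row S \<Longrightarrow> s i \<in> {1, -1}"
    and eq: "\<And>i j. i < dim_row S \<Longrightarrow> j < dim_row S \<Longrightarrow> S' $$ (i, j) = s i * s j * S $$ (\<pi> i, \<pi> j)"
    and dim: "dim_row S' = dim_row S"
    using assms by (auto simp: switches_to_def)
  have bij': "bij_betw ?\<rho> ?A ?A" by (rule bij_betw_inv_into[OF bij])
  have \<rho>: "?\<rho> i < dim_row S" "\<pi> (?\<rho> i) = i" if "i < dim_row S" for i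
    using bij' bij_betw_inv_into_right[OF bij] that bij_betwE by blast+
  have sq: "s i * s i = 1" if "i < dim_row S" for i using s[OF that] by auto
  have "S $$ (i, j) = s (?\<rho> i) * s (?\<rho> j) * S' $$ (?\<rho> i, ?\<rho> j)"
    if "i < dim_row S" "j < dim_row S" for i j
    using eq[OF \<rho>(1)[OF that(1)] \<rho>(1)[OF that(2)]] \<rho>(2) that
      sq[OF \<rho>(1)[OF that(1)]] sq[OF \<rho>(1)[OF that(2)]]
    by (simp add: algebra_simps)
  then show ?thesis
    unfolding switches_to_def dim using bij' s \<rho>(1) by simp
qed

lemma switches_to_trans:
  assumes "switches_to S \<pi> s S'" "switches_to S' \<rho> t S''"
  shows "switches_to S (\<pi> \<circ> \<rho>) (\<lambda>i. t i * s (\<rho> i)) S''"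
proof -
  let ?A = "{..<dim_row S}"
  have a: "bij_betw \<pi> ?A ?A" "bij_betw \<rho> ?A ?A" using assms by (auto simp: switches_to_def)
  then have "\<rho> i < dim_row S" if "i < dim_row S" for i using that bij_betwE by blast
  moreover have "bij_betw (\<pi> \<circ> \<rho>) ?A ?A" using a bij_betw_trans by blast
  moreover have "t i * s (\<rho> i) \<in> {1, -1}" if "i < dim_row S" for i
  proof -
    have "t i \<in> {1, -1}" "s (\<rho> i) \<in> {1, -1}"
      using assms calculation(1) that unfolding switches_to_def by auto
    then show ?thesis by auto
  qed
  ultimately show ?thesis using assms unfolding switches_to_def by (simp add: mult_ac)
qed

lemma switching_rel_refl: "seidel_mat S \<Longrightarrow> (S, S) \<in> switching_rel"
  unfolding switching_rel_iff using switches_to_refl by blast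

lemma switching_rel_sym: "(S, S') \<in> switching_rel \<Longrightarrow> (S', S) \<in> switching_rel"
  unfolding switching_rel_iff using switches_to_sym by blast

lemma switching_rel_trans:
  "(S, S') \<in> switching_rel \<Longrightarrow> (S', S'') \<in> switching_rel \<Longrightarrow> (S, S'') \<in> switching_rel"
  unfolding switching_rel_iff using switches_to_trans by blast

lemma switching_class_eq_iff:
  assumes "seidel_mat S"
  shows "switching_class S = switching_class S' \<longleftrightarrow> (S, S') \<in> switching_rel"
  using switching_rel_refl[OF assms] switching_rel_sym switching_rel_trans
  unfolding switching_class_def by blast

abbreviation gram :: "nat \<Rightarrow> real mat \<Rightarrow> real mat" where
  "gram n S \<equiv> 3 \<cdot>\<^sub>m 1\<^sub>m n - S"

text \<open>A relabelling of indices with signs carries independent columns to independent columns.\<close>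

lemma rank_gram_switching_le:
  assumes "(S, S') \<in> switching_rel" and n: "dim_row S = n"
  shows "vec_space.rank n (gram n S') \<le> vec_space.rank n (gram n S)"
proof -
  interpret vec_space "TYPE(real)" n .
  obtain \<pi> s where S: "seidel_mat S" "seidel_mat S'" and sw: "switches_to S \<pi> s S'"
    using assms by (auto simp: switching_rel_iff)
  have Sc: "S \<in> carrier_mat n n" "S' \<in> carrier_mat n n"
    using seidel_mat_carrier[OF S(1) n] seidel_mat_carrier[OF S(2), of n] sw n
    by (simp_all add: switches_to_def)
  note sw' = sw[unfolded switches_to_def n]
  have \<pi>: "\<pi> i < n" if "i < n" for i using sw' that bij_betwE by blast
  have inj: "\<pi> i = \<pi> j \<longleftrightarrow> i = j" if "i < n" "j < n" for i j
    using sw' that unfolding bij_betw_def inj_on_def by blast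
  have sq: "s i * s i = 1" if "i < n" for i using sw' that by auto
  have gram_eq: "gram n S' $$ (i, j) = s i * s j * gram n S $$ (\<pi> i, \<pi> j)" if "i < n" "j < n" for i j
    using that Sc sw' \<pi> inj[OF that] sq by (simp add: algebra_simps)
  have gram_carrier: "gram n S \<in> carrier_mat n n" "gram n S' \<in> carrier_mat n n"
    using Sc by (simp_all add: minus_carrier_mat)
  let ?k = "rank (gram n S')"
  obtain p where p: "\<And>l. l < ?k \<Longrightarrow> p l < n"
    and ind: "\<And>c l. (\<And>i. i < n \<Longrightarrow> (\<Sum>l<?k. gram n S' $$ (i, p l) * c l) = 0) \<Longrightarrow> l < ?k \<Longrightarrow> c l = 0"
    using le_rank_iff_independent_columns[OF gram_carrier(2), of ?k] by blast
  have "c l = 0" if c: "\<And>i. i < n \<Longrightarrow> (\<Sum>l<?k. gram n S $$ (i, \<pi> (p l)) * c l) = 0" and l: "l < ?k" for c l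
  proof -
    have "(\<Sum>l<?k. gram n S' $$ (i, p l) * (s (p l) * c l)) = 0" if i: "i < n" for i
    proof -
      have "(\<Sum>l<?k. gram n S' $$ (i, p l) * (s (p l) * c l)) =
          (\<Sum>l<?k. s i * (gram n S $$ (\<pi> i, \<pi> (p l)) * c l))"
      proof (intro sum.cong refl)
        fix l assume "l \<in> {..<?k}"
        then have pl: "p l < n" using p by simp
        have "gram n S' $$ (i, p l) * (s (p l) * c l) =
            (s (p l) * s (p l)) * (s i * (gram n S $$ (\<pi> i, \<pi> (p l)) * c l))"
          unfolding gram_eq[OF i pl] by (simp only: mult.assoc mult.commute mult.left_commute)
        then show "gram n S' $$ (i, p l) * (s (p l) * c l) = s i * (gram n S $$ (\<pi> i, \<pi> (p l)) * c l)"
          using sq[OF pl] by simp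
      qed
      also have "\<dots> = s i * (\<Sum>l<?k. gram n S $$ (\<pi> i, \<pi> (p l)) * c l)"
        by (simp only: sum_distrib_left)
      finally show ?thesis using c[OF \<pi>[OF i]] by simp
    qed
    then have "s (p l) * c l = 0" using ind[of "\<lambda>l. s (p l) * c l"] l by blast
    then show ?thesis using sq[OF p[OF l]] by auto
  qed
  moreover have "\<pi> (p l) < n" if "l < ?k" for l using \<pi> p that by blast
  ultimately have "?k \<le> rank (gram n S)"
    unfolding le_rank_iff_independent_columns[OF gram_carrier(1)]
    by (intro exI[of _ "\<lambda>l. \<pi> (p l)"]) blast
  then show ?thesis .
qed

lemma switching_rel_dim: "(S, S') \<in> switching_rel \<Longrightarrow> dim_row S' = dim_row S"
  by (auto simp: switching_rel_iff switches_to_def)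

lemma rank_gram_switching:
  assumes "(S, S') \<in> switching_rel" "dim_row S = n"
  shows "vec_space.rank n (gram n S') = vec_space.rank n (gram n S)"
  using rank_gram_switching_le[OF assms] rank_gram_switching_le[OF switching_rel_sym[OF assms(1)]]
    switching_rel_dim[OF assms(1)] assms(2) by simp

section \<open>The graphs with a removed matching\<close>

text \<open>The vertex matched with \<open>i\<close> in the standard perfect matching \<open>{0,1}, {2,3}, ...\<close> of the natural numbers.\<close>

definition partner :: "nat \<Rightarrow> nat" where
  "partner i = (if even i then Suc i else i - 1)"

lemma std_matching_iff: "{i, j} \<in> std_matching b \<longleftrightarrow> i < 2 * b \<and> j = partner i"
proof
  assume "{i, j} \<in> std_matching b"
  then show "i < 2 * b \<and> j = partner i"
    by (auto simp: std_matching_def partner_def doubleton_eq_iff)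
next
  assume a: "i < 2 * b \<and> j = partner i"
  then have "{i, j} = {2 * (i div 2), 2 * (i div 2) + 1}"
    by (cases "even i") (auto simp: partner_def elim!: evenE oddE)
  moreover have "i div 2 < b" using a by (simp add: less_mult_imp_div_less)
  ultimately show "{i, j} \<in> std_matching b" unfolding std_matching_def by blast
qed

lemma partner_neq: "partner i \<noteq> i"
  by (auto simp: partner_def elim: oddE)

lemma partner_partner [simp]: "partner (partner i) = i"
  by (auto simp: partner_def elim: oddE)

lemma partner_less: "i < 2 * b \<Longrightarrow> partner i < 2 * b"
  by (auto simp: partner_def)

lemma seidel_D_dim [simp]:
  "dim_row (seidel_of_graph (D_graph a b)) = a + b" "dim_col (seidel_of_graph (D_graph a b)) = a + b"
  by (simp_all add: seidel_of_graph_def adj_matrix_def all_ones_mat_def D_graph_def)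

lemma seidel_D_entry:
  assumes "i < a + b" "j < a + b"
  shows "seidel_of_graph (D_graph a b) $$ (i, j) =
    (if i = j then 0 else if i < 2 * b \<and> j = partner i then 1 else -1)"
proof -
  have "{i, j} \<in> snd (D_graph a b) \<longleftrightarrow> i \<noteq> j \<and> \<not> (i < 2 * b \<and> j = partner i)"
    using assms by (auto simp: D_graph_def complete_graph_def std_matching_iff card_insert_if)
  then show ?thesis
    using assms by (auto simp: seidel_of_graph_def adj_matrix_def all_ones_mat_def D_graph_def)
qed

lemma seidel_mat_D: "seidel_mat (seidel_of_graph (D_graph a b))"
proof -
  let ?S = "seidel_of_graph (D_graph a b)"
  have "?S\<^sup>T = ?S"
    by (rule eq_matI) (auto simp: seidel_D_entry dest: partner_less)
  then show ?thesis by (simp add: seidel_mat_def seidel_D_entry)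
qed

lemma complete_graph_eq_D: "complete_graph n = D_graph n 0"
  by (simp add: complete_graph_def D_graph_def std_matching_def)

lemma gram_D_row:
  fixes x :: "nat \<Rightarrow> real"
  assumes b: "b \<le> a" and i: "i < a + b"
  shows "(\<Sum>j<a+b. gram (a + b) (seidel_of_graph (D_graph a b)) $$ (i, j) * x j) =
    (\<Sum>j<a+b. x j) + 2 * x i - (if i < 2 * b then 2 * x (partner i) else 0)"
proof -
  have "gram (a + b) (seidel_of_graph (D_graph a b)) $$ (i, j) * x j =
    x j + (if j = i then 2 * x i else 0) - (if j = partner i then if i < 2 * b then 2 * x j else 0 else 0)"
    if "j < a + b" for j
    using that i partner_neq[of i] by (auto simp: seidel_D_entry)
  then have "(\<Sum>j<a+b. gram (a + b) (seidel_of_graph (D_graph a b)) $$ (i, j) * x j) =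
    (\<Sum>j<a+b. x j + (if j = i then 2 * x i else 0) -
      (if j = partner i then if i < 2 * b then 2 * x j else 0 else 0))"
    by (intro sum.cong refl) auto
  also have "\<dots> = (\<Sum>j<a+b. x j) + 2 * x i - (if i < 2 * b then 2 * x (partner i) else 0)"
    using i b partner_less[of i b] by (auto simp: sum.distrib sum_subtractf)
  finally show ?thesis .
qed

lemma sum_over_pairs: "(\<Sum>i<2*b. f i) = (\<Sum>k<b. f (2 * k) + f (2 * k + 1))"
  for f :: "nat \<Rightarrow> 'a :: comm_monoid_add"
  by (induction b) (simp_all add: add.assoc)

text \<open>The quadratic form is \<open>(\<Sum>\<^sub>j x\<^sub>j)\<^sup>2 + 2 \<Sum>\<^sub>k (x\<^sub>2\<^sub>k - x\<^sub>2\<^sub>k\<^sub>+\<^sub>1)\<^sup>2 + 2 \<Sum>\<^sub>i x\<^sub>i\<^sup>2\<close>, where \<open>k\<close> runs over the matched pairs and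
\<open>i\<close> over the unmatched vertices.\<close>

lemma gram_D_nonneg:
  fixes x :: "nat \<Rightarrow> real"
  assumes b: "b \<le> a"
  shows "0 \<le> (\<Sum>i<a+b. \<Sum>j<a+b. x i * gram (a + b) (seidel_of_graph (D_graph a b)) $$ (i, j) * x j)"
proof -
  let ?T = "\<Sum>j<a+b. x j"
  have "(\<Sum>i<a+b. \<Sum>j<a+b. x i * gram (a + b) (seidel_of_graph (D_graph a b)) $$ (i, j) * x j) =
    (\<Sum>i<a+b. x i * ?T + (2 * (x i)\<^sup>2 - (if i < 2 * b then 2 * (x i * x (partner i)) else 0)))"
  proof (intro sum.cong refl)
    fix i assume "i \<in> {..<a+b}"
    then have i: "i < a + b" by simp
    have "(\<Sum>j<a+b. x i * gram (a + b) (seidel_of_graph (D_graph a b)) $$ (i, j) * x j) =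
      x i * (\<Sum>j<a+b. gram (a + b) (seidel_of_graph (D_graph a b)) $$ (i, j) * x j)"
      by (simp only: sum_distrib_left mult.assoc)
    also have "\<dots> = x i * ?T + (2 * (x i)\<^sup>2 - (if i < 2 * b then 2 * (x i * x (partner i)) else 0))"
      unfolding gram_D_row[OF b i] by (simp add: algebra_simps power2_eq_square)
    finally show "(\<Sum>j<a+b. x i * gram (a + b) (seidel_of_graph (D_graph a b)) $$ (i, j) * x j) =
      x i * ?T + (2 * (x i)\<^sup>2 - (if i < 2 * b then 2 * (x i * x (partner i)) else 0))" .
  qed
  also have "\<dots> = ?T * ?T + (\<Sum>i<a+b. 2 * (x i)\<^sup>2 - (if i < 2 * b then 2 * (x i * x (partner i)) else 0))"
    by (simp only: sum.distrib sum_distrib_right)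
  also have "(\<Sum>i<a+b. 2 * (x i)\<^sup>2 - (if i < 2 * b then 2 * (x i * x (partner i)) else 0)) =
    (\<Sum>i<2*b. 2 * (x i)\<^sup>2 - 2 * (x i * x (partner i))) + (\<Sum>i=2*b..<a+b. 2 * (x i)\<^sup>2)"
  proof -
    have split: "(\<Sum>i<a+b. f i) = (\<Sum>i<2*b. f i) + (\<Sum>i=2*b..<a+b. f i)" for f :: "nat \<Rightarrow> real"
      using sum.atLeastLessThan_concat[of 0 "2*b" "a+b" f] b by (simp add: lessThan_atLeast0)
    show ?thesis unfolding split by (intro arg_cong2[where f = "(+)"] sum.cong) simp_all
  qed
  also have "(\<Sum>i<2*b. 2 * (x i)\<^sup>2 - 2 * (x i * x (partner i))) =
    (\<Sum>k<b. 2 * (x (2 * k) - x (2 * k + 1))\<^sup>2)"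
    unfolding sum_over_pairs
    by (intro sum.cong refl) (simp add: partner_def power2_eq_square algebra_simps)
  finally show ?thesis by (simp add: sum_nonneg)
qed

text \<open>The columns in \<open>J\<close> are independent if the kernel of \<open>A\<close> contains no nonzero vector supported on \<open>J\<close>.\<close>

lemma (in vec_space) le_rank_of_support:
  assumes A: "A \<in> carrier_mat n nc" and J: "J \<subseteq> {..<nc}"
    and ind: "\<And>x j. (\<And>j. j \<notin> J \<Longrightarrow> x j = 0) \<Longrightarrow> (\<And>i. i < n \<Longrightarrow> (\<Sum>j<nc. A $$ (i, j) * x j) = 0) \<Longrightarrow> x j = 0"
  shows "card J \<le> rank A"
proof -
  have "finite J" using J finite_subset by blast
  then obtain p where p: "bij_betw p {..<card J} J"
    using ex_bij_betw_nat_finite[of J] by (auto simp: atLeast0LessThan)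
  have "c l = 0" if c: "\<And>i. i < n \<Longrightarrow> (\<Sum>l<card J. A $$ (i, p l) * c l) = 0" and l: "l < card J" for c l
  proof -
    define x where "x j = (if j \<in> J then c (inv_into {..<card J} p j) else 0)" for j
    have xp: "x (p l) = c l" if "l < card J" for l
      using that p by (simp add: x_def bij_betw_inv_into_left) (use bij_betwE in blast)
    have kernel: "(\<Sum>j<nc. A $$ (i, j) * x j) = 0" if i: "i < n" for i
    proof -
      have "(\<Sum>j<nc. A $$ (i, j) * x j) = (\<Sum>j\<in>J. A $$ (i, j) * x j)"
        using J by (intro sum.mono_neutral_right) (auto simp: x_def)
      also have "\<dots> = (\<Sum>l<card J. A $$ (i, p l) * x (p l))"
        by (rule sum.reindex_bij_betw[OF p, symmetric])
      also have "\<dots> = (\<Sum>l<card J. A $$ (i, p l) * c l)"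
        by (intro sum.cong refl) (simp add: xp)
      finally show ?thesis using c i by simp
    qed
    have "x j = 0" if "j \<notin> J" for j using that by (simp add: x_def)
    then have "x (p l) = 0" using ind[of x "p l"] kernel by blast
    then show ?thesis using xp l by simp
  qed
  moreover have "p l < nc" if "l < card J" for l using p J that bij_betwE by blast
  ultimately show ?thesis unfolding le_rank_iff_independent_columns[OF A] by blast
qed

lemma gram_carrier: "dim_row S = n \<Longrightarrow> dim_col S = n \<Longrightarrow> gram n S \<in> carrier_mat n n"
  by (intro minus_carrier_mat carrier_matI)

lemma rank_gram_complete:
  "vec_space.rank n (gram n (seidel_of_graph (D_graph n 0))) = n"
proof -
  interpret vec_space "TYPE(real)" n .
  let ?G = "gram n (seidel_of_graph (D_graph n 0))"
  have G: "?G \<in> carrier_mat n n" by (rule gram_carrier) simp_all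
  have "card {..<n} \<le> rank ?G"
  proof (rule le_rank_of_support[OF G])
    fix x :: "nat \<Rightarrow> real" and j
    assume supp: "\<And>j. j \<notin> {..<n} \<Longrightarrow> x j = 0"
      and x: "\<And>i. i < n \<Longrightarrow> (\<Sum>j<n. ?G $$ (i, j) * x j) = 0"
    let ?T = "\<Sum>j<n. x j"
    have xi: "?T + 2 * x i = 0" if "i < n" for i
      using x[OF that] gram_D_row[of 0 n i x] that by simp
    have "0 = (\<Sum>i<n. ?T + 2 * x i)" using xi by simp
    also have "\<dots> = (real n + 2) * ?T" by (simp add: sum.distrib sum_distrib_left[symmetric] distrib_right)
    finally have "?T = 0" by (simp add: add_nonneg_eq_0_iff)
    then show "x j = 0" using xi[of j] supp[of j] by (cases "j < n") auto
  qed simp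
  then show ?thesis using rank_le_nc[OF G] by simp
qed

text \<open>The kernel consists of the vectors with coordinate sum 0 that are constant on the matched pairs and vanish at unmatched vertices.
This is the kernel of \<open>a + 1\<close> functionals. For the lower bound one keeps a single vertex from each matched pair but the first: rows 0
and 1 then force the coordinate sum to vanish, and the other rows kill the coordinates one by one.\<close>

lemma rank_gram_D:
  assumes b: "1 \<le> b" "b \<le> a"
  shows "vec_space.rank (a + b) (gram (a + b) (seidel_of_graph (D_graph a b))) = a + 1"
proof -
  interpret vec_space "TYPE(real)" "a + b" .
  let ?n = "a + b"
  let ?G = "gram ?n (seidel_of_graph (D_graph a b))"
  have G: "?G \<in> carrier_mat ?n ?n" by (rule gram_carrier) simp_all
  have "rank ?G \<le> a + 1"
  proof (rule rank_le_of_kernel[OF G])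
    define m :: "nat \<Rightarrow> nat \<Rightarrow> real" where "m k j = (if k = 0 then 1
      else if k \<le> b then (if j = 2 * (k - 1) then 1 else 0) - (if j = 2 * (k - 1) + 1 then 1 else 0)
      else if j = k - 1 + b then 1 else 0)" for k j
    fix x :: "nat \<Rightarrow> real" and i
    assume ker: "\<And>k. k < a + 1 \<Longrightarrow> (\<Sum>j<?n. m k j * x j) = 0" and i: "i < ?n"
    have total: "(\<Sum>j<?n. x j) = 0" using ker[of 0] by (simp add: m_def)
    have pairs: "x (2 * k) = x (2 * k + 1)" if "k < b" for k
    proof -
      have "(\<Sum>j<?n. m (Suc k) j * x j) =
        (\<Sum>j<?n. (if j = 2 * k then x j else 0) - (if j = 2 * k + 1 then x j else 0))"
        by (intro sum.cong refl) (use that in \<open>auto simp: m_def\<close>)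
      also have "\<dots> = x (2 * k) - x (2 * k + 1)"
        using that b by (simp add: sum_subtractf)
      finally show ?thesis using ker[of "Suc k"] that b by simp
    qed
    have singles: "x j = 0" if "2 * b \<le> j" "j < ?n" for j
    proof -
      have "(\<Sum>l<?n. m (Suc (j - b)) l * x l) = (\<Sum>l<?n. if l = j then x l else 0)"
        by (intro sum.cong refl) (use that b in \<open>auto simp: m_def\<close>)
      also have "\<dots> = x j" using that by simp
      finally show ?thesis using ker[of "Suc (j - b)"] that b by simp
    qed
    have "x i = x (partner i)" if "i < 2 * b"
      using pairs[of "i div 2"] that by (cases "even i") (auto simp: partner_def elim!: evenE oddE)
    then show "(\<Sum>j<?n. ?G $$ (i, j) * x j) = 0"
      unfolding gram_D_row[OF b(2) i] using total singles[of i] i by simp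
  qed
  moreover have "a + 1 \<le> rank ?G"
  proof -
    define K where "K = (\<lambda>k. 2 * k + 1) ` {1..<b}"
    have K: "finite K" "K \<subseteq> {..<?n}" "card K = b - 1"
      using b by (auto simp: K_def card_image inj_on_def)
    have "card ({..<?n} - K) \<le> rank ?G"
    proof (rule le_rank_of_support[OF G])
      fix x :: "nat \<Rightarrow> real" and j
      assume supp: "\<And>j. j \<notin> {..<?n} - K \<Longrightarrow> x j = 0"
        and x: "\<And>i. i < ?n \<Longrightarrow> (\<Sum>j<?n. ?G $$ (i, j) * x j) = 0"
      let ?T = "\<Sum>j<?n. x j"
      have row: "?T + 2 * x i - (if i < 2 * b then 2 * x (partner i) else 0) = 0" if "i < ?n" for i
        using x[OF that] gram_D_row[OF b(2) that] by simp
      have T: "?T = 0" and eq: "x 0 = x 1" using row[of 0] row[of 1] b by (auto simp: partner_def)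
      have rest: "x j = 0" if j: "2 \<le> j" for j
      proof (cases "j < 2 * b")
        case True
        have "j div 2 \<in> {1..<b}" using j True by auto
        show ?thesis
        proof (cases "even j")
          case True
          then have "partner j = 2 * (j div 2) + 1" by (simp add: partner_def)
          then have "x (partner j) = 0"
            using supp[of "partner j"] \<open>j div 2 \<in> {1..<b}\<close> unfolding K_def by blast
          then show ?thesis using row[of j] T \<open>j < 2 * b\<close> b by simp
        next
          case False
          then have "j = 2 * (j div 2) + 1" by simp
          then show ?thesis using supp[of j] \<open>j div 2 \<in> {1..<b}\<close> unfolding K_def by blast
        qed
      next
        case False
        then show ?thesis using row[of j] T supp[of j] by (cases "j < ?n") auto
      qed
      have "?T = (\<Sum>j\<in>{0, 1}. x j)"
        using rest b by (intro sum.mono_neutral_right) (auto simp: not_less_eq_eq numeral_2_eq_2)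
      then have "x 0 = 0" "x 1 = 0" using T eq by simp_all
      then show "x j = 0" using rest[of j] by (cases "j = 0 \<or> j = 1") auto
    qed blast
    then show ?thesis using K b by (simp add: card_Diff_subset)
  qed
  ultimately show ?thesis by simp
qed

text \<open>Remove the two ends of one edge, enumerate the rest, and put the removed edge in front.\<close>

lemma matching_enumeration:
  assumes "finite V"
    and irrefl: "\<And>i. i \<in> V \<Longrightarrow> \<not> M i i"
    and sym: "\<And>i j. i \<in> V \<Longrightarrow> j \<in> V \<Longrightarrow> M i j \<Longrightarrow> M j i"
    and matching: "\<And>i j k. i \<in> V \<Longrightarrow> j \<in> V \<Longrightarrow> k \<in> V \<Longrightarrow> M i j \<Longrightarrow> M i k \<Longrightarrow> j = k"
  shows "\<exists>\<pi> b. bij_betw \<pi> {..<card V} V \<and> 2 * b \<le> card V \<and>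
    (\<forall>i<card V. \<forall>j<card V. M (\<pi> i) (\<pi> j) \<longleftrightarrow> i < 2 * b \<and> j = partner i)"
  using assms
proof (induction V rule: finite_psubset_induct)
  case (psubset V)
  show ?case
  proof (cases "\<exists>x\<in>V. \<exists>y\<in>V. M x y")
    case False
    obtain \<pi> where \<pi>: "bij_betw \<pi> {..<card V} V"
      using ex_bij_betw_nat_finite[OF psubset.hyps(1)] by (auto simp: atLeast0LessThan)
    then have "\<pi> i \<in> V" if "i < card V" for i using that bij_betwE by blast
    then show ?thesis using \<pi> False by (intro exI[of _ \<pi>] exI[of _ 0]) auto
  next
    case True
    then obtain x y where xy: "x \<in> V" "y \<in> V" "M x y" "M y x"
      using psubset.prems(2) by blast
    then have ne: "x \<noteq> y" using psubset.prems(1) by blast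
    let ?W = "V - {x, y}"
    have W: "?W \<subset> V" using xy by blast
    have "card {x, y} \<le> card V" using xy psubset.hyps(1) by (intro card_mono) auto
    then have cardV: "card V = Suc (Suc (card ?W))"
      using xy ne by (simp add: card_Diff_subset)
    have "\<exists>\<rho> b. bij_betw \<rho> {..<card ?W} ?W \<and> 2 * b \<le> card ?W \<and>
      (\<forall>i<card ?W. \<forall>j<card ?W. M (\<rho> i) (\<rho> j) \<longleftrightarrow> i < 2 * b \<and> j = partner i)"
    proof (rule psubset.IH[OF W])
      show "\<not> M i i" if "i \<in> ?W" for i using psubset.prems(1) that by blast
      show "M j i" if "i \<in> ?W" "j \<in> ?W" "M i j" for i j using psubset.prems(2) that by blast
      show "j = k" if "i \<in> ?W" "j \<in> ?W" "k \<in> ?W" "M i j" "M i k" for i j k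
        using psubset.prems(3)[of i j k] that by blast
    qed
    then obtain \<rho> b where \<rho>: "bij_betw \<rho> {..<card ?W} ?W" "2 * b \<le> card ?W"
      and M: "\<And>i j. i < card ?W \<Longrightarrow> j < card ?W \<Longrightarrow> M (\<rho> i) (\<rho> j) \<longleftrightarrow> i < 2 * b \<and> j = partner i"
      by blast
    have \<rho>W: "\<rho> i \<in> V" "\<rho> i \<noteq> x" "\<rho> i \<noteq> y" if "i < card ?W" for i
      using bij_betwE[OF \<rho>(1)] that by blast+
    define \<pi> where "\<pi> i = (if i = 0 then x else if i = 1 then y else \<rho> (i - 2))" for i
    have "{..<card V} = insert 0 (insert 1 ((\<lambda>i. i + 2) ` {..<card ?W}))"
    proof -
      have "k \<in> (\<lambda>i. i + 2) ` {..<card ?W}" if "k < card V" "k \<noteq> 0" "k \<noteq> 1" for k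
        using that cardV by (intro image_eqI[of _ _ "k - 2"]) auto
      then show ?thesis using cardV by auto
    qed
    then have "\<pi> ` {..<card V} = insert (\<pi> 0) (insert (\<pi> 1) ((\<lambda>i. \<pi> (i + 2)) ` {..<card ?W}))"
      by (simp only: image_insert image_image)
    also have "\<dots> = insert x (insert y (\<rho> ` {..<card ?W}))" by (simp add: \<pi>_def)
    also have "\<dots> = V" using \<rho>(1) xy by (auto simp: bij_betw_def)
    finally have img: "\<pi> ` {..<card V} = V" .
    then have "bij_betw \<pi> {..<card V} V"
      by (simp add: bij_betw_def eq_card_imp_inj_on)
    moreover have "M (\<pi> i) (\<pi> j) \<longleftrightarrow> i < 2 * Suc b \<and> j = partner i"
      if ij: "i < card V" "j < card V" for i j
    proof -
      have Mx: "M x z \<longleftrightarrow> z = y" if "z \<in> V" for z using psubset.prems(3) xy that by blast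
      have My: "M y z \<longleftrightarrow> z = x" if "z \<in> V" for z using psubset.prems(3) xy that by blast
      have Mz: "\<not> M z x" "\<not> M z y" if "z \<in> V" "z \<noteq> x" "z \<noteq> y" for z
        using Mx[OF that(1)] My[OF that(1)] psubset.prems(2) xy that by blast+
      have V: "\<pi> j \<in> V" using img ij by blast
      consider "i = 0" | "i = 1" | i' where "i = i' + 2" "i' < card ?W"
        using ij(1) cardV by (metis One_nat_def Suc_less_eq add_2_eq_Suc' not0_implies_Suc)
      then show ?thesis
      proof cases
        case 1
        then show ?thesis using Mx[OF V] ne \<rho>W[of "j - 2"] ij(2) cardV
          by (auto simp: \<pi>_def partner_def)
      next
        case 2
        then show ?thesis using My[OF V] ne \<rho>W[of "j - 2"] ij(2) cardV
          by (auto simp: \<pi>_def partner_def)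
      next
        case 3
        have \<pi>i: "\<pi> i = \<rho> i'" using 3 by (simp add: \<pi>_def)
        have p: "partner i = partner i' + 2" using 3 by (auto simp: partner_def elim: oddE)
        consider "j = 0" | "j = 1" | j' where "j = j' + 2" "j' < card ?W"
          using ij(2) cardV by (metis One_nat_def Suc_less_eq add_2_eq_Suc' not0_implies_Suc)
        then show ?thesis
        proof cases
          case 1
          then show ?thesis using Mz(1)[OF \<rho>W[OF 3(2)]] \<pi>i p by (simp add: \<pi>_def)
        next
          case 2
          then show ?thesis using Mz(2)[OF \<rho>W[OF 3(2)]] \<pi>i p by (simp add: \<pi>_def)
        next
          case j: 3
          then show ?thesis using M[OF 3(2) j(2)] \<pi>i p 3(1) by (simp add: \<pi>_def)
        qed
      qed
    qed
    moreover have "2 * Suc b \<le> card V" using \<rho>(2) cardV by simp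
    ultimately show ?thesis by blast
  qed
qed

section \<open>Classification in rank at least eight\<close>

lemma gram_entry:
  "S \<in> carrier_mat n n \<Longrightarrow> i < n \<Longrightarrow> j < n \<Longrightarrow> gram n S $$ (i, j) = (if i = j then 3 else 0) - S $$ (i, j)"
  by simp

lemma seidel_mat_entries:
  assumes "seidel_mat S" "dim_row S = n"
  shows "i < n \<Longrightarrow> S $$ (i, i) = 0"
    and "i < n \<Longrightarrow> j < n \<Longrightarrow> i \<noteq> j \<Longrightarrow> S $$ (i, j) \<in> {1, -1}"
    and "i < n \<Longrightarrow> j < n \<Longrightarrow> S $$ (i, j) = S $$ (j, i)"
proof -
  show "S $$ (i, i) = 0" if "i < n" using assms that unfolding seidel_mat_def by blast
  show "S $$ (i, j) \<in> {1, -1}" if "i < n" "j < n" "i \<noteq> j"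
    using assms that unfolding seidel_mat_def by blast
  show "S $$ (i, j) = S $$ (j, i)" if "i < n" "j < n"
  proof -
    have "S\<^sup>T $$ (j, i) = S $$ (i, j)"
      using seidel_mat_carrier[OF assms] that by (intro index_transpose_mat) auto
    moreover have "S\<^sup>T = S" using assms unfolding seidel_mat_def by blast
    ultimately show ?thesis by simp
  qed
qed

lemma eigenvalue_le_3_of_nonneg:
  fixes S :: "real mat"
  assumes S: "S \<in> carrier_mat n n"
    and nonneg: "\<And>x. 0 \<le> (\<Sum>i<n. \<Sum>j<n. x i * gram n S $$ (i, j) * x j)"
    and k: "eigenvalue S k"
  shows "k \<le> 3"
proof -
  obtain v where v: "v \<in> carrier_vec n" "v \<noteq> 0\<^sub>v n" "S *\<^sub>v v = k \<cdot>\<^sub>v v"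
    using k S unfolding eigenvalue_def eigenvector_def by auto
  have row: "(\<Sum>j<n. S $$ (i, j) * v $ j) = k * v $ i" if "i < n" for i
  proof -
    have "(S *\<^sub>v v) $ i = (\<Sum>j<n. S $$ (i, j) * v $ j)"
      using that S v(1) by (simp add: scalar_prod_def atLeast0LessThan)
    then show ?thesis using v that by simp
  qed
  have gram_row: "(\<Sum>j<n. gram n S $$ (i, j) * v $ j) = (3 - k) * v $ i" if "i < n" for i
  proof -
    have "(\<Sum>j<n. gram n S $$ (i, j) * v $ j) =
      (\<Sum>j<n. (if j = i then 3 * v $ i else 0) - S $$ (i, j) * v $ j)"
      by (intro sum.cong refl) (use S that in \<open>auto simp: algebra_simps\<close>)
    also have "\<dots> = (3 - k) * v $ i" using that row[OF that] by (simp add: sum_subtractf algebra_simps)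
    finally show ?thesis .
  qed
  have "(\<Sum>i<n. \<Sum>j<n. v $ i * gram n S $$ (i, j) * v $ j) =
    (\<Sum>i<n. v $ i * (\<Sum>j<n. gram n S $$ (i, j) * v $ j))"
    by (simp only: sum_distrib_left mult.assoc)
  also have "\<dots> = (\<Sum>i<n. (3 - k) * (v $ i)\<^sup>2)"
    by (intro sum.cong refl) (simp add: gram_row power2_eq_square del: index_minus_mat)
  finally have ge: "0 \<le> (3 - k) * (\<Sum>i<n. (v $ i)\<^sup>2)"
    using nonneg[of "\<lambda>i. v $ i"] by (simp only: sum_distrib_left)
  have "\<exists>i<n. v $ i \<noteq> 0"
  proof (rule ccontr)
    assume "\<not> ?thesis"
    then have "v = 0\<^sub>v n" using v(1) by (intro eq_vecI) auto
    then show False using v(2) by simp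
  qed
  then have "0 < (\<Sum>i<n. (v $ i)\<^sup>2)" by (auto intro!: sum_pos2)
  then show ?thesis using ge by (simp add: zero_le_mult_iff)
qed

lemma gram_nonneg_of_eigenvalue_le_3:
  assumes S: "seidel_mat S" "dim_row S = n" and le: "\<And>k. eigenvalue S k \<Longrightarrow> k \<le> 3"
  shows "0 \<le> (\<Sum>i<n. \<Sum>j<n. x i * gram n S $$ (i, j) * x j)"
proof (rule nonneg_of_no_negative_eigenvalue)
  note Sc = seidel_mat_carrier[OF S]
  show "gram n S $$ (i, j) = gram n S $$ (j, i)" if "i < n" "j < n" for i j
    unfolding gram_entry[OF Sc that] gram_entry[OF Sc that(2,1)] using seidel_mat_entries(3)[OF S that] by auto
  fix t :: real assume t: "t > 0"
  have "\<not> eigenvalue S (3 + t)" using le[of "3 + t"] t by auto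
  then have "det (char_matrix S (3 + t)) \<noteq> 0" by (simp add: eigenvalue_det[OF Sc])
  moreover have "mat n n (\<lambda>(i, j). gram n S $$ (i, j) + (if i = j then t else 0)) = - char_matrix S (3 + t)"
    by (rule eq_matI) (use Sc in \<open>auto simp: char_matrix_def\<close>)
  moreover have "char_matrix S (3 + t) \<in> carrier_mat n n" using Sc by (simp add: char_matrix_def)
  ultimately show "det (mat n n (\<lambda>(i, j). gram n S $$ (i, j) + (if i = j then t else 0))) \<noteq> 0"
    by (simp add: det_0_negate)
qed

lemma eigenvalue_3_iff_rank:
  assumes S: "S \<in> carrier_mat n n"
  shows "eigenvalue S 3 \<longleftrightarrow> vec_space.rank n (gram n S) < n"
proof -
  interpret vec_space "TYPE(real)" n .
  have G: "gram n S \<in> carrier_mat n n" using S by (intro minus_carrier_mat)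
  have c: "char_matrix S 3 \<in> carrier_mat n n" using S by (simp add: char_matrix_def)
  have "gram n S = - char_matrix S 3"
    by (rule eq_matI) (use S in \<open>auto simp: char_matrix_def\<close>)
  then have "eigenvalue S 3 \<longleftrightarrow> det (gram n S) = 0"
    using eigenvalue_det[OF S] det_0_negate[OF c] by simp
  also have "\<dots> \<longleftrightarrow> rank (gram n S) < n"
    using det_rank_iff[OF G] rank_le_nc[OF G] by auto
  finally show ?thesis .
qed

lemma matching_switches_to_D:
  assumes S: "seidel_mat S" "dim_row S = n"
    and s: "\<And>i. s i \<in> {1, -1}"
    and matching: "\<And>i j k. i < n \<Longrightarrow> j < n \<Longrightarrow> k < n \<Longrightarrow> i \<noteq> j \<Longrightarrow> i \<noteq> k \<Longrightarrow>
      s i * s j * S $$ (i, j) = 1 \<Longrightarrow> s i * s k * S $$ (i, k) = 1 \<Longrightarrow> j = k"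
  obtains a b where "b \<le> a" "a + b = n" "(S, seidel_of_graph (D_graph a b)) \<in> switching_rel"
proof -
  define M where "M i j \<longleftrightarrow> i \<noteq> j \<and> s i * s j * S $$ (i, j) = 1" for i j
  have "\<exists>\<pi> b. bij_betw \<pi> {..<card {..<n}} {..<n} \<and> 2 * b \<le> card {..<n} \<and>
    (\<forall>i<card {..<n}. \<forall>j<card {..<n}. M (\<pi> i) (\<pi> j) \<longleftrightarrow> i < 2 * b \<and> j = partner i)"
  proof (rule matching_enumeration)
    show "\<not> M i i" for i by (simp add: M_def)
    show "M j i" if "i \<in> {..<n}" "j \<in> {..<n}" "M i j" for i j
      using that seidel_mat_entries(3)[OF S, of i j] by (auto simp: M_def mult.commute)
    show "j = k" if "i \<in> {..<n}" "j \<in> {..<n}" "k \<in> {..<n}" "M i j" "M i k" for i j k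
      using that matching[of i j k] by (auto simp: M_def)
  qed simp
  then obtain \<pi> b where \<pi>: "bij_betw \<pi> {..<n} {..<n}" and b: "2 * b \<le> n"
    and M: "\<And>i j. i < n \<Longrightarrow> j < n \<Longrightarrow> M (\<pi> i) (\<pi> j) \<longleftrightarrow> i < 2 * b \<and> j = partner i"
    by auto
  define a where "a = n - b"
  have ab: "b \<le> a" "a + b = n" using b by (auto simp: a_def)
  have lt: "\<pi> i < n" if "i < n" for i using \<pi> that bij_betwE by blast
  have inj: "\<pi> i = \<pi> j \<longleftrightarrow> i = j" if "i < n" "j < n" for i j
    using \<pi> that unfolding bij_betw_def inj_on_def by blast
  have "seidel_of_graph (D_graph a b) $$ (i, j) = s (\<pi> i) * s (\<pi> j) * S $$ (\<pi> i, \<pi> j)"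
    if ij: "i < n" "j < n" for i j
  proof (cases "i = j")
    case True
    then show ?thesis using seidel_mat_entries(1)[OF S lt[OF ij(1)]] ij ab by (simp add: seidel_D_entry)
  next
    case False
    have "S $$ (\<pi> i, \<pi> j) \<in> {1, -1}"
      using seidel_mat_entries(2)[OF S lt[OF ij(1)] lt[OF ij(2)]] inj[OF ij] False by blast
    then have "s (\<pi> i) * s (\<pi> j) * S $$ (\<pi> i, \<pi> j) \<in> {1, -1}"
      using s[of "\<pi> i"] s[of "\<pi> j"] by auto
    then show ?thesis
      using False M[OF ij] inj[OF ij] ij ab unfolding M_def by (auto simp: seidel_D_entry)
  qed
  then have "switches_to S \<pi> (s \<circ> \<pi>) (seidel_of_graph (D_graph a b))"
    using \<pi> s ab S(2) by (auto simp: switches_to_def)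
  then have "(S, seidel_of_graph (D_graph a b)) \<in> switching_rel"
    unfolding switching_rel_iff using S(1) seidel_mat_D by blast
  then show thesis using that ab by blast
qed

text \<open>Either triangle case produces signs for which the pairs with inner product \<open>-1\<close> form a matching. The remaining possibility, two pillars,
puts the common kernel of seven functionals into the kernel of \<open>G\<close>, against the assumption on the rank.\<close>

lemma rank_le_7_or_switches_to_D:
  assumes S: "seidel_mat S" "dim_row S = n"
    and nonneg: "\<And>x. 0 \<le> (\<Sum>i<n. \<Sum>j<n. x i * gram n S $$ (i, j) * x j)"
    and rank: "\<not> vec_space.rank n (gram n S) \<le> 7"
  obtains a b where "b \<le> a" "a + b = n" "(S, seidel_of_graph (D_graph a b)) \<in> switching_rel"
proof -
  note Sc = seidel_mat_carrier[OF S]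
  note entries = seidel_mat_entries[OF S]
  interpret vec_space "TYPE(real)" n .
  define G where "G i j = gram n S $$ (i, j)" for i j
  have G: "G i j = (if i = j then 3 else 0) - S $$ (i, j)" if "i < n" "j < n" for i j
    unfolding G_def using gram_entry[OF Sc that] .
  interpret seidel_form n G
  proof
    show "G i j = G j i" if "i < n" "j < n" for i j using that entries(3)[OF that] by (simp add: G)
    show "0 \<le> (\<Sum>i<n. \<Sum>j<n. x i * G i j * x j)" for x using nonneg unfolding G_def .
    show "G i i = 3" if "i < n" for i using that entries(1)[OF that] by (simp add: G)
    show "G i j \<in> {1, -1}" if "i < n" "j < n" "i \<noteq> j" for i j
      using that entries(2)[OF that] by (auto simp: G)
  qed
  have no_seven: "\<not> (\<exists>v :: nat \<Rightarrow> nat \<Rightarrow> real. \<forall>i t. i < n \<longrightarrow> (\<forall>k<7. form (v k) t = 0) \<longrightarrow> form (unit i) t = 0)"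
  proof
    assume "\<exists>v :: nat \<Rightarrow> nat \<Rightarrow> real. \<forall>i t. i < n \<longrightarrow> (\<forall>k<7. form (v k) t = 0) \<longrightarrow> form (unit i) t = 0"
    then obtain v :: "nat \<Rightarrow> nat \<Rightarrow> real"
      where v: "\<And>i t. i < n \<Longrightarrow> (\<And>k. k < 7 \<Longrightarrow> form (v k) t = 0) \<Longrightarrow> form (unit i) t = 0"
      by blast
    have form_sum: "form y t = (\<Sum>j<n. (\<Sum>i<n. y i * G i j) * t j)" for y t
      unfolding form_def by (subst sum.swap) (simp add: sum_distrib_right)
    have "rank (gram n S) \<le> 7"
    proof (rule rank_le_of_kernel)
      show "gram n S \<in> carrier_mat n n" using Sc by (intro minus_carrier_mat)
      fix t i assume "\<And>k. k < 7 \<Longrightarrow> (\<Sum>j<n. (\<Sum>i<n. v k i * G i j) * t j) = 0" and i: "i < n"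
      then have "form (unit i) t = 0" using v[OF i] form_sum by simp
      then show "(\<Sum>j<n. gram n S $$ (i, j) * t j) = 0"
        unfolding form_unit_left[OF i] G_def .
    qed
    then show False using rank by blast
  qed
  have "\<exists>s :: nat \<Rightarrow> real. (\<forall>i. s i \<in> {1, -1}) \<and> (\<forall>i j k. i < n \<longrightarrow> j < n \<longrightarrow> k < n \<longrightarrow>
    s i * s j * G i j = -1 \<longrightarrow> s i * s k * G i k = -1 \<longrightarrow> j = k)"
  proof (cases "\<exists>i1 i2 i3. i1 < n \<and> i2 < n \<and> i3 < n \<and> i1 \<noteq> i2 \<and> i1 \<noteq> i3 \<and> i2 \<noteq> i3 \<and>
      G i1 i2 * G i1 i3 * G i2 i3 = -1")
    case True
    then obtain i1 i2 i3 where i: "i1 < n" "i2 < n" "i3 < n" "i1 \<noteq> i2" "i1 \<noteq> i3" "i2 \<noteq> i3"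
      "G i1 i2 * G i1 i3 * G i2 i3 = -1" by blast
    obtain u where u: "form u u = 1" "\<forall>i<n. form (unit i) u \<in> {1, -1}"
      using negative_triangle_cases[OF i] no_seven by blast
    show ?thesis by (rule unit_vector_matching[OF u]) blast
  next
    case False
    obtain s :: "nat \<Rightarrow> real" where "\<And>i. s i \<in> {1, -1}"
      and "\<And>i j. i < n \<Longrightarrow> j < n \<Longrightarrow> s i * s j * G i j \<noteq> -1"
      by (rule no_negative_triangle_matching) (use False in blast)+
    then show ?thesis by (intro exI[of _ s]) blast
  qed
  then obtain s :: "nat \<Rightarrow> real" where s: "\<And>i. s i \<in> {1, -1}"
    and matching: "\<And>i j k. i < n \<Longrightarrow> j < n \<Longrightarrow> k < n \<Longrightarrow>
      s i * s j * G i j = -1 \<Longrightarrow> s i * s k * G i k = -1 \<Longrightarrow> j = k" by blast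
  have unique: "j = k" if "i < n" "j < n" "k < n" "i \<noteq> j" "i \<noteq> k"
    "s i * s j * S $$ (i, j) = 1" "s i * s k * S $$ (i, k) = 1" for i j k
    using matching[OF that(1-3)] that by (simp add: G)
  show thesis by (rule matching_switches_to_D[OF S s unique]) (assumption | rule that)+
qed

lemma carrier_D: "a + b = n \<Longrightarrow> seidel_of_graph (D_graph a b) \<in> carrier_mat n n"
  by (intro carrier_matI) simp_all

lemma D_in_seidel_le3:
  assumes "b \<le> a" "a + b = n"
  shows "seidel_of_graph (D_graph a b) \<in> \<S> n"
proof -
  have "k \<le> 3" if "eigenvalue (seidel_of_graph (D_graph a b)) k" for k
    using eigenvalue_le_3_of_nonneg[OF carrier_D[OF refl] gram_D_nonneg[OF assms(1)] that] .
  then show ?thesis using assms(2) seidel_mat_D by (simp add: seidel_le3_def)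
qed

text \<open>The product of the three entries over a triangle is invariant under switching. It is \<open>-1\<close> on all triangles of the complete graph, but it is 1 on a triangle that contains exactly one removed edge, such as that of the vertices 0, 1, 2.\<close>

lemma complete_not_switching_D:
  assumes "1 \<le> b" "b \<le> a" "a + b = n" "3 \<le> n"
  shows "(seidel_of_graph (D_graph n 0), seidel_of_graph (D_graph a b)) \<notin> switching_rel"
proof
  let ?K = "seidel_of_graph (D_graph n 0)" and ?D = "seidel_of_graph (D_graph a b)"
  assume "(?K, ?D) \<in> switching_rel"
  then obtain \<pi> s where sw: "switches_to ?K \<pi> s ?D" by (auto simp: switching_rel_iff)
  then have bij: "bij_betw \<pi> {..<n} {..<n}" and s: "\<And>i. i < n \<Longrightarrow> s i \<in> {1, -1}"
    and eq: "\<And>i j. i < n \<Longrightarrow> j < n \<Longrightarrow> ?D $$ (i, j) = s i * s j * ?K $$ (\<pi> i, \<pi> j)"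
    unfolding switches_to_def by auto
  have lt: "\<pi> i < n" if "i < n" for i using bij that bij_betwE by blast
  have inj: "\<pi> i = \<pi> j \<longleftrightarrow> i = j" if "i < n" "j < n" for i j
    using bij that unfolding bij_betw_def inj_on_def by blast
  have e: "?D $$ (i, j) = - (s i * s j)" if "i < n" "j < n" "i \<noteq> j" for i j
    using eq[OF that(1,2)] lt[OF that(1)] lt[OF that(2)] inj[OF that(1,2)] that(3)
    by (simp add: seidel_D_entry)
  have "- (s 0 * s 1) = 1" "- (s 0 * s 2) = -1" "- (s 1 * s 2) = -1"
    using e[of 0 1] e[of 0 2] e[of 1 2] assms by (simp_all add: seidel_D_entry partner_def)
  then show False using s[of 0] s[of 1] s[of 2] assms(4) by auto
qed

section \<open>Switching classes\<close>

lemma quotient_switching_rel: "X // switching_rel = switching_class ` X"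
  by (auto simp: quotient_def switching_class_def)

lemma seidel_le3_carrier: "S \<in> \<S> n \<Longrightarrow> S \<in> carrier_mat n n"
  unfolding seidel_le3_def using seidel_mat_carrier by blast

lemma seidel_eq3_iff: "S \<in> \<T> n \<longleftrightarrow> S \<in> \<S> n \<and> vec_space.rank n (gram n S) < n"
  using eigenvalue_3_iff_rank[of S n] seidel_mat_carrier[of S n]
  unfolding seidel_le3_def seidel_eq3_def by blast

lemma Omega_iff: "S \<in> \<Omega> n \<longleftrightarrow> S \<in> \<S> n \<and> vec_space.rank n (gram n S) \<le> 7"
  by (simp add: Omega_def)

lemma rank_gram_le: "S \<in> \<S> n \<Longrightarrow> vec_space.rank n (gram n S) \<le> n"
  using vec_space.rank_le_nc[OF minus_carrier_mat[OF seidel_le3_carrier]] by blast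

lemma outside_Omega_switches_to_D:
  assumes S: "S \<in> \<S> n" "S \<notin> \<Omega> n"
  obtains a b where "b \<le> a" "a + b = n" "(S, seidel_of_graph (D_graph a b)) \<in> switching_rel"
    "b = 0 \<or> 7 \<le> a" "vec_space.rank n (gram n S) = (if b = 0 then n else a + 1)"
proof -
  have S': "seidel_mat S" "dim_row S = n" "\<And>k. eigenvalue S k \<Longrightarrow> k \<le> 3"
    using S(1) by (auto simp: seidel_le3_def)
  have rank: "\<not> vec_space.rank n (gram n S) \<le> 7" using S by (simp add: Omega_iff)
  obtain a b where ab: "b \<le> a" "a + b = n" "(S, seidel_of_graph (D_graph a b)) \<in> switching_rel"
    by (rule rank_le_7_or_switches_to_D[OF S'(1,2) gram_nonneg_of_eigenvalue_le_3[OF S'] rank])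
  have eq: "vec_space.rank n (gram n S) = (if b = 0 then n else a + 1)"
    using rank_gram_switching[OF ab(3) S'(2)] rank_gram_complete[of n] rank_gram_D[of b a] ab(1,2)
    by (cases "b = 0") auto
  then show thesis using that[OF ab _ eq] rank by (cases "b = 0") auto
qed

lemma rank_gram_D_of_index:
  assumes "b \<le> a" "a + b = n" "1 \<le> b"
  shows "vec_space.rank n (gram n (seidel_of_graph (D_graph a b))) = a + 1"
  using rank_gram_D[of b a] assms by simp

text \<open>The parameter \<open>m\<close> exceeds the rank by one: \<open>a = m - 2\<close>, and \<open>m \<ge> 9\<close> means rank at least 8. The condition \<open>m \<ge> \<lceil>n/2\<rceil> + 2\<close>
says \<open>b \<le> a\<close>, and the upper bound \<open>n + 1\<close> or \<open>n\<close> for \<open>m\<close> says \<open>b \<ge> 1\<close> or \<open>b \<ge> 2\<close>.\<close>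

lemma D_classes_reindex:
  assumes u: "u \<le> n + 1"
  shows "{switching_class (seidel_of_graph (D_graph (m - 2) (n + 2 - m))) | m.
      m \<in> {max 9 (nat \<lceil>real n / 2\<rceil> + 2)..u}} =
    {switching_class (seidel_of_graph (D_graph a b)) | a b. a + b = n \<and> b \<le> a \<and> 7 \<le> a \<and> a + 2 \<le> u}"
    (is "{?f m | m. m \<in> ?M} = {?g a b | a b. ?P a b}")
proof -
  have half: "nat \<lceil>real n / 2\<rceil> \<le> a \<longleftrightarrow> n \<le> 2 * a" for a
    by (auto simp: nat_le_iff ceiling_le_iff)
  show ?thesis
  proof (intro equalityI subsetI)
    fix c assume "c \<in> {?f m | m. m \<in> ?M}"
    then obtain m where m: "m \<in> ?M" "c = ?f m" by blast
    then have "9 \<le> m" "nat \<lceil>real n / 2\<rceil> + 2 \<le> m" "m \<le> u"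
      by (simp_all only: atLeastAtMost_iff max.bounded_iff)
    then have "9 \<le> m" "nat \<lceil>real n / 2\<rceil> \<le> m - 2" "m \<le> u" by linarith+
    then have "?P (m - 2) (n + 2 - m)" using u unfolding half by linarith
    then show "c \<in> {?g a b | a b. ?P a b}" using m(2) by blast
  next
    fix c assume "c \<in> {?g a b | a b. ?P a b}"
    then obtain a b where ab: "?P a b" "c = ?g a b" by blast
    then have "nat \<lceil>real n / 2\<rceil> \<le> a" unfolding half by linarith
    then have "a + 2 \<in> ?M" using ab by simp
    moreover have "c = ?f (a + 2)" using ab by auto
    ultimately show "c \<in> {?f m | m. m \<in> ?M}" by blast
  qed
qed

theorem theorem6p1:
  fixes n :: nat
  shows
    "(n \<le> 7 \<longrightarrow> \<S> n // switching_rel = \<Omega> n // switching_rel) \<and>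
     (\<not> n \<le> 7 \<longrightarrow>
        (let
           A = \<Omega> n // switching_rel;
           B = {switching_class (seidel_of_graph (complete_graph n))};
           C = {switching_class (seidel_of_graph (D_graph (m - 2) (n + 2 - m))) | m.
                  m \<in> {max 9 (nat \<lceil>real n / 2\<rceil> + 2)..n + 1}}
         in \<S> n // switching_rel = A \<union> B \<union> C \<and> A \<inter> B = {} \<and> A \<inter> C = {} \<and> B \<inter> C = {})) \<and>
     (n \<le> 8 \<longrightarrow> \<T> n // switching_rel = \<Theta> n // switching_rel) \<and>
     (\<not> n \<le> 8 \<longrightarrow>
        (let
           A = \<Omega> n // switching_rel;
           C = {switching_class (seidel_of_graph (D_graph (m - 2) (n + 2 - m))) | m.
                  m \<in> {max 9 (nat \<lceil>real n / 2\<rceil> + 2)..n}}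
         in \<T> n // switching_rel = A \<union> C \<and> A \<inter> C = {}))"
proof -
  let ?D = "\<lambda>a b. seidel_of_graph (D_graph a b)"
  let ?A = "\<Omega> n // switching_rel"
  let ?B = "{switching_class (?D n 0)}"
  let ?C = "\<lambda>u. {switching_class (?D a b) | a b. a + b = n \<and> b \<le> a \<and> 7 \<le> a \<and> a + 2 \<le> u}"
  have D_le3: "?D a b \<in> \<S> n" if "b \<le> a" "a + b = n" for a b using D_in_seidel_le3 that .
  have class_eq: "(S, S') \<in> switching_rel" if "switching_class S = switching_class S'" "S \<in> \<S> n" for S S'
    using switching_class_eq_iff[of S S'] that by (simp add: seidel_le3_def)
  have class_eqI: "switching_class S = switching_class S'" if "(S, S') \<in> switching_rel" for S S'
    using switching_class_eq_iff[of S S'] that by (simp add: switching_rel_iff)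
  have rank_eq: "vec_space.rank n (gram n S') = vec_space.rank n (gram n S)"
    if "switching_class S = switching_class S'" "S \<in> \<S> n" for S S'
    using rank_gram_switching[OF class_eq[OF that]] that(2) by (simp add: seidel_le3_def)
  have AC: "?A \<inter> ?C u = {}" if "u \<le> n + 1" for u
  proof -
    have False if "S \<in> \<Omega> n" "switching_class S = switching_class (?D a b)"
      "a + b = n" "b \<le> a" "7 \<le> a" "a + 2 \<le> u" for S a b
      using rank_eq[OF that(2)] rank_gram_D_of_index[of b a n] that \<open>u \<le> n + 1\<close> by (auto simp: Omega_iff)
    then show ?thesis by (auto simp: quotient_switching_rel)
  qed
  have small_S: "\<S> n = \<Omega> n" if "n \<le> 7"
    using that order.trans[OF rank_gram_le that] by (auto simp: Omega_iff simp del: index_minus_mat)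
  have small_T: "\<T> n = \<Theta> n" if "n \<le> 8"
    using that by (auto simp: Theta_def Omega_iff seidel_eq3_iff)
  have large_S: "\<S> n // switching_rel = ?A \<union> ?B \<union> ?C (n + 1) \<and> ?A \<inter> ?B = {} \<and> ?B \<inter> ?C (n + 1) = {}"
    if n: "\<not> n \<le> 7"
  proof (intro conjI equalityI subsetI)
    fix c assume "c \<in> \<S> n // switching_rel"
    then obtain S where S: "S \<in> \<S> n" "c = switching_class S" by (auto simp: quotient_switching_rel)
    show "c \<in> ?A \<union> ?B \<union> ?C (n + 1)"
    proof (cases "S \<in> \<Omega> n")
      case True
      then show ?thesis using S by (simp add: quotient_switching_rel)
    next
      case False
      then obtain a b where ab: "b \<le> a" "a + b = n" "(S, ?D a b) \<in> switching_rel" "b = 0 \<or> 7 \<le> a"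
        using outside_Omega_switches_to_D[OF S(1)] by metis
      have c: "c = switching_class (?D a b)" using class_eqI[OF ab(3)] S(2) by simp
      show ?thesis
      proof (cases "b = 0")
        case True
        then show ?thesis using c ab by simp
      next
        case False
        then have "c \<in> ?C (n + 1)" using c ab by (intro CollectI exI[of _ a] exI[of _ b]) auto
        then show ?thesis by blast
      qed
    qed
  next
    fix c assume "c \<in> ?A \<union> ?B \<union> ?C (n + 1)"
    then show "c \<in> \<S> n // switching_rel"
      using D_le3 by (auto simp: quotient_switching_rel Omega_iff)
  next
    fix c assume "c \<in> ?A \<inter> ?B"
    then obtain S where S: "S \<in> \<Omega> n" "switching_class S = switching_class (?D n 0)"
      by (auto simp: quotient_switching_rel)
    then have "vec_space.rank n (gram n (?D n 0)) \<le> 7" using rank_eq[OF S(2)] by (simp add: Omega_iff)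
    then show "c \<in> {}" using n rank_gram_complete[of n] by simp
  next
    fix c assume "c \<in> ?B \<inter> ?C (n + 1)"
    then obtain a b where ab: "a + b = n" "b \<le> a" "a + 2 \<le> n + 1"
      "switching_class (?D n 0) = switching_class (?D a b)" by auto
    then have "(?D n 0, ?D a b) \<in> switching_rel" using class_eq D_le3[of 0 n] by simp
    then show "c \<in> {}" using complete_not_switching_D[of b a n] ab n by simp
  qed simp_all
  have large_T: "\<T> n // switching_rel = ?A \<union> ?C n" if n: "\<not> n \<le> 8"
  proof (intro equalityI subsetI)
    fix c assume "c \<in> \<T> n // switching_rel"
    then obtain S where S: "S \<in> \<T> n" "c = switching_class S" by (auto simp: quotient_switching_rel)
    show "c \<in> ?A \<union> ?C n"
    proof (cases "S \<in> \<Omega> n")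
      case True
      then show ?thesis using S by (simp add: quotient_switching_rel)
    next
      case False
      then obtain a b where ab: "b \<le> a" "a + b = n" "(S, ?D a b) \<in> switching_rel" "b = 0 \<or> 7 \<le> a"
        "vec_space.rank n (gram n S) = (if b = 0 then n else a + 1)"
        using outside_Omega_switches_to_D[of S n] S(1) seidel_eq3_iff by metis
      have c: "c = switching_class (?D a b)" using class_eqI[OF ab(3)] S(2) by simp
      have "b \<noteq> 0" "a + 2 \<le> n" using ab(5) S(1) by (auto simp: seidel_eq3_iff split: if_splits)
      then have "c \<in> ?C n" using c ab by (intro CollectI exI[of _ a] exI[of _ b]) auto
      then show ?thesis by blast
    qed
  next
    fix c assume "c \<in> ?A \<union> ?C n"
    then consider S where "S \<in> \<Omega> n" "c = switching_class S"
      | a b where "a + b = n" "b \<le> a" "7 \<le> a" "a + 2 \<le> n" "c = switching_class (?D a b)"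
      by (auto simp: quotient_switching_rel)
    then show "c \<in> \<T> n // switching_rel"
    proof cases
      case 1
      then show ?thesis using n by (auto simp: quotient_switching_rel seidel_eq3_iff Omega_iff)
    next
      case 2
      then have "?D a b \<in> \<T> n"
        using D_le3[of b a] rank_gram_D_of_index[of b a n] by (auto simp: seidel_eq3_iff)
      then show ?thesis using 2 by (simp add: quotient_switching_rel)
    qed
  qed
  show ?thesis
    unfolding Let_def D_classes_reindex[OF order_refl] D_classes_reindex[OF le_add1] complete_graph_eq_D
  proof (intro conjI impI)
    show "\<S> n // switching_rel = ?A" if "n \<le> 7" by (simp only: small_S[OF that])
    show "\<T> n // switching_rel = \<Theta> n // switching_rel" if "n \<le> 8" by (simp only: small_T[OF that])
    show "?A \<inter> ?C (n + 1) = {}" by (rule AC[OF order_refl])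
    show "?A \<inter> ?C n = {}" by (rule AC[OF le_add1])
  next
    assume "\<not> n \<le> 7"
    note large = large_S[OF this]
    show "\<S> n // switching_rel = ?A \<union> ?B \<union> ?C (n + 1)" by (rule large[THEN conjunct1])
    show "?A \<inter> ?B = {}" by (rule large[THEN conjunct2, THEN conjunct1])
    show "?B \<inter> ?C (n + 1) = {}" by (rule large[THEN conjunct2, THEN conjunct2])
  next
    assume "\<not> n \<le> 8"
    then show "\<T> n // switching_rel = ?A \<union> ?C n" by (rule large_T)
  qed
qed

end
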